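(* Let $p\in\mathbb{N}$ and let $J$ be the periodic Jacobi operator on $\ell^2(\mathbb{Z})$ with real coefficient sequences $\{a_i\}_{i\in\mathbb{Z}}$, $\{b_i\}_{i\in\mathbb{Z}}$, $\{c_i\}_{i\in\mathbb{Z}}$, all periodic with the same period $p$. Define $\omega_{bc}=\max\{|b_i-c_i|: i=0,1,\ldots,p-1\}$. If $\Lambda_\epsilon(J)$ is path-connected for some $\epsilon\ge\omega_{bc}$, then $$\omega_a\le 2(\epsilon+\omega_{bc})(p-1).$$
   Context: For real sequences $\{a_i\},\{b_i\},\{c_i\}$ indexed by $\mathbb{Z}$ with $a_{i+p}=a_i$, $b_{i+p}=b_i$, $c_{i+p}=c_i$ for all $i$, the periodic Jacobi operator $J$ is the bounded (in general non-normal) linear operator on the complex Hilbert space $\ell^2(\mathbb{Z})$ given by the tridiagonal matrix with $$(Ju)_n=c_{n-1}u_{n-1}+a_nu_n+b_nu_{n+1},\qquad n\in\mathbb{Z}.$$ For a bounded operator $A$ on a complex Hilbert space with spectrum $\sigma(A)$ and $\epsilon>0$, the $\epsilon$-pseudospectrum is $$\Lambda_\epsilon(A)=\sigma(A)\cup\{z\in\mathbb{C}:\ z\notin\sigma(A),\ \|(zI-A)^{-1}\|\ge \epsilon^{-1}\},$$ and $\Lambda_0(A)=\sigma(A)$. Notation: $\omega_a=\max\{|a_i-a_j|: i,j=0,1,2,\ldots\}$. *)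

theory Defs
  imports "HOL-Analysis.Analysis"
begin

section \<open>Complex Hilbert spaces, spectrum and pseudospectrum\<close>

text \<open>
  A complex Hilbert space is a real Hilbert space carrying a compatible complex scalar
  multiplication and a sesquilinear inner product (linear in the first argument) whose real part
  is the real inner product; hence \<open>norm x = sqrt (Re (cinner x x))\<close>, see
  \<open>norm_eq_sqrt_cinner\<close> below.
\<close>

class complex_hilbert_space = real_inner + banach +
  fixes scaleC :: "complex \<Rightarrow> 'a \<Rightarrow> 'a"  (infixr "*\<^sub>C" 75)
    and cinner :: "'a \<Rightarrow> 'a \<Rightarrow> complex"
  assumes scaleC_add_right: "z *\<^sub>C (x + y) = z *\<^sub>C x + z *\<^sub>C y"
    and scaleC_add_left: "(z + w) *\<^sub>C x = z *\<^sub>C x + w *\<^sub>C x"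
    and scaleC_scaleC: "z *\<^sub>C (w *\<^sub>C x) = (z * w) *\<^sub>C x"
    and scaleR_scaleC: "r *\<^sub>R x = complex_of_real r *\<^sub>C x"
    and cinner_commute: "cinner x y = cnj (cinner y x)"
    and cinner_add_left: "cinner (x + y) v = cinner x v + cinner y v"
    and cinner_scaleC_left: "cinner (z *\<^sub>C x) y = z * cinner x y"
    and inner_eq_Re_cinner: "inner x y = Re (cinner x y)"

lemma norm_eq_sqrt_cinner: "norm x = sqrt (Re (cinner x x))"
  for x :: "'a::complex_hilbert_space"
  by (simp add: norm_eq_sqrt_inner inner_eq_Re_cinner)

definition bounded_clinear :: "('a::complex_hilbert_space \<Rightarrow> 'b::complex_hilbert_space) \<Rightarrow> bool"
  where "bounded_clinear A \<longleftrightarrow> bounded_linear A \<and> (\<forall>z x. A (z *\<^sub>C x) = z *\<^sub>C A x)"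

definition op_resolvent ::
    "('a::complex_hilbert_space \<Rightarrow> 'a) \<Rightarrow> complex \<Rightarrow> 'a \<Rightarrow> 'a"
  where "op_resolvent A z = inv (\<lambda>x. z *\<^sub>C x - A x)"

definition op_spectrum :: "('a::complex_hilbert_space \<Rightarrow> 'a) \<Rightarrow> complex set"
  where "op_spectrum A =
    {z. \<not> (bij (\<lambda>x. z *\<^sub>C x - A x) \<and> bounded_clinear (op_resolvent A z))}"

text \<open>
  The guard \<open>\<epsilon> > 0\<close> yields the convention that the \<open>0\<close>-pseudospectrum is the spectrum
  (recall that \<open>1 / 0 = 0\<close>).
\<close>

definition pseudospectrum :: "real \<Rightarrow> ('a::complex_hilbert_space \<Rightarrow> 'a) \<Rightarrow> complex set"
  where "pseudospectrum \<epsilon> A =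
    op_spectrum A \<union> {z. \<epsilon> > 0 \<and> z \<notin> op_spectrum A \<and> onorm (op_resolvent A z) \<ge> 1 / \<epsilon>}"

lemma pseudospectrum_0: "pseudospectrum 0 A = op_spectrum A"
  by (simp add: pseudospectrum_def)


section \<open>The Hilbert space of square-summable families\<close>

typedef 'i ell2 = "{u :: 'i \<Rightarrow> complex. (\<lambda>i. (cmod (u i))\<^sup>2) summable_on UNIV}"
  morphisms ell2_nth Abs_ell2
  by (rule exI[of _ "\<lambda>_. 0"]) simp

setup_lifting type_definition_ell2

lemma ell2_eqI: "(\<And>i. ell2_nth u i = ell2_nth v i) \<Longrightarrow> u = v"
  by (auto simp: fun_eq_iff simp flip: ell2_nth_inject)

lemma ell2_nth_summable: "(\<lambda>i. (cmod (ell2_nth u i))\<^sup>2) summable_on UNIV"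
  using ell2_nth[of u] by simp

lemma square_summable_add:
  fixes u v :: "'i \<Rightarrow> complex"
  assumes "(\<lambda>i. (cmod (u i))\<^sup>2) summable_on UNIV" "(\<lambda>i. (cmod (v i))\<^sup>2) summable_on UNIV"
  shows "(\<lambda>i. (cmod (u i + v i))\<^sup>2) summable_on UNIV"
proof (rule summable_on_comparison_test)
  show "(\<lambda>i. 2 * (cmod (u i))\<^sup>2 + 2 * (cmod (v i))\<^sup>2) summable_on UNIV"
    using assms by (intro summable_on_add summable_on_cmult_right)
  fix i
  have "(cmod (u i + v i))\<^sup>2 \<le> (cmod (u i) + cmod (v i))\<^sup>2"
    by (intro power_mono norm_triangle_ineq) auto
  also have "\<dots> \<le> 2 * (cmod (u i))\<^sup>2 + 2 * (cmod (v i))\<^sup>2"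
    using sum_squares_bound[of "cmod (u i)" "cmod (v i)"] by (simp add: power2_sum)
  finally show "(cmod (u i + v i))\<^sup>2 \<le> 2 * (cmod (u i))\<^sup>2 + 2 * (cmod (v i))\<^sup>2" .
qed simp

lemma square_summable_bounded_mult:
  fixes u f :: "'i \<Rightarrow> complex"
  assumes "(\<lambda>i. (cmod (u i))\<^sup>2) summable_on UNIV" "\<And>i. cmod (f i) \<le> C"
  shows "(\<lambda>i. (cmod (f i * u i))\<^sup>2) summable_on UNIV"
proof (rule summable_on_comparison_test)
  show "(\<lambda>i. C\<^sup>2 * (cmod (u i))\<^sup>2) summable_on UNIV"
    using assms by (intro summable_on_cmult_right)
  show "(cmod (f i * u i))\<^sup>2 \<le> C\<^sup>2 * (cmod (u i))\<^sup>2" for i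
    unfolding norm_mult power_mult_distrib
    by (intro mult_right_mono power_mono assms) auto
qed simp

lemma ell2_mult_summable: "(\<lambda>i. ell2_nth u i * cnj (ell2_nth v i)) summable_on UNIV"
proof -
  have "(\<lambda>i. norm (ell2_nth u i * cnj (ell2_nth v i))) summable_on UNIV"
  proof (rule summable_on_comparison_test)
    show "(\<lambda>i. (cmod (ell2_nth u i))\<^sup>2 + (cmod (ell2_nth v i))\<^sup>2) summable_on UNIV"
      by (intro summable_on_add ell2_nth_summable)
    fix i
    have "0 \<le> cmod (ell2_nth u i) * cmod (ell2_nth v i)"
      by simp
    then show "norm (ell2_nth u i * cnj (ell2_nth v i))
        \<le> (cmod (ell2_nth u i))\<^sup>2 + (cmod (ell2_nth v i))\<^sup>2"
      using sum_squares_bound[of "cmod (ell2_nth u i)" "cmod (ell2_nth v i)"]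
      unfolding norm_mult complex_mod_cnj by linarith
  qed simp
  then show ?thesis
    by (rule abs_summable_summable)
qed

instantiation ell2 :: (type) real_vector
begin

lift_definition zero_ell2 :: "'a ell2" is "\<lambda>_. 0"
  by simp

lift_definition plus_ell2 :: "'a ell2 \<Rightarrow> 'a ell2 \<Rightarrow> 'a ell2" is "\<lambda>u v i. u i + v i"
  by (auto intro: square_summable_add)

lift_definition uminus_ell2 :: "'a ell2 \<Rightarrow> 'a ell2" is "\<lambda>u i. - u i"
  by simp

lift_definition scaleR_ell2 :: "real \<Rightarrow> 'a ell2 \<Rightarrow> 'a ell2" is "\<lambda>r u i. r *\<^sub>R u i"
  by (simp add: power_mult_distrib summable_on_cmult_right)

definition minus_ell2 :: "'a ell2 \<Rightarrow> 'a ell2 \<Rightarrow> 'a ell2"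
  where "minus_ell2 u v = u + (- v)"

instance
proof
  fix u v w :: "'a ell2" and r s :: real
  show "u - v = u + - v" by (fact minus_ell2_def)
qed (rule ell2_eqI, simp add: plus_ell2.rep_eq zero_ell2.rep_eq uminus_ell2.rep_eq
    scaleR_ell2.rep_eq algebra_simps)+

end

instantiation ell2 :: (type) real_inner
begin

definition inner_ell2 :: "'a ell2 \<Rightarrow> 'a ell2 \<Rightarrow> real"
  where "inner_ell2 u v = Re (\<Sum>\<^sub>\<infinity>i. ell2_nth u i * cnj (ell2_nth v i))"

definition norm_ell2 :: "'a ell2 \<Rightarrow> real"
  where "norm_ell2 u = sqrt (\<Sum>\<^sub>\<infinity>i. (cmod (ell2_nth u i))\<^sup>2)"

definition sgn_ell2 :: "'a ell2 \<Rightarrow> 'a ell2"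
  where "sgn_ell2 u = u /\<^sub>R norm u"

definition dist_ell2 :: "'a ell2 \<Rightarrow> 'a ell2 \<Rightarrow> real"
  where "dist_ell2 u v = norm (u - v)"

definition uniformity_ell2 :: "('a ell2 \<times> 'a ell2) filter"
  where "uniformity_ell2 = (INF e\<in>{0 <..}. principal {(x, y). dist x y < e})"

definition open_ell2 :: "'a ell2 set \<Rightarrow> bool"
  where "open_ell2 U = (\<forall>x\<in>U. eventually (\<lambda>(x', y). x' = x \<longrightarrow> y \<in> U) uniformity)"

lemma inner_ell2_self: "inner u u = (\<Sum>\<^sub>\<infinity>i. (cmod (ell2_nth u i))\<^sup>2)" for u :: "'a ell2"
proof -
  have "inner u u = (\<Sum>\<^sub>\<infinity>i. Re (ell2_nth u i * cnj (ell2_nth u i)))"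
    unfolding inner_ell2_def by (rule infsum_Re[OF ell2_mult_summable, symmetric])
  also have "\<dots> = (\<Sum>\<^sub>\<infinity>i. (cmod (ell2_nth u i))\<^sup>2)"
    unfolding complex_norm_square[symmetric] by simp
  finally show ?thesis .
qed

instance
proof
  fix u v w :: "'a ell2" and r :: real
  show "dist u v = norm (u - v)" by (fact dist_ell2_def)
  show "sgn u = u /\<^sub>R norm u" by (fact sgn_ell2_def)
  show "(uniformity :: ('a ell2 \<times> 'a ell2) filter) =
      (INF e\<in>{0 <..}. principal {(x, y). dist x y < e})"
    by (fact uniformity_ell2_def)
  show "open U = (\<forall>x\<in>U. eventually (\<lambda>(x', y). x' = x \<longrightarrow> y \<in> U) uniformity)"
    for U :: "'a ell2 set"
    by (fact open_ell2_def)
  show "inner u v = inner v u"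
  proof -
    have "(\<Sum>\<^sub>\<infinity>i. ell2_nth u i * cnj (ell2_nth v i)) =
        cnj (\<Sum>\<^sub>\<infinity>i. ell2_nth v i * cnj (ell2_nth u i))"
      by (subst infsum_cnj[symmetric]) (simp add: mult.commute)
    then show ?thesis by (simp add: inner_ell2_def)
  qed
  show "inner (u + v) w = inner u w + inner v w"
    by (simp add: inner_ell2_def plus_ell2.rep_eq distrib_right infsum_add ell2_mult_summable)
  show "inner (r *\<^sub>R u) v = r * inner u v"
    by (simp add: inner_ell2_def scaleR_ell2.rep_eq infsum_scaleR_right)
  show "0 \<le> inner u u"
    by (simp add: inner_ell2_self infsum_nonneg)
  show "inner u u = 0 \<longleftrightarrow> u = 0"
  proof
    assume "inner u u = 0"
    then have "(cmod (ell2_nth u i))\<^sup>2 = 0" for i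
      by (intro nonneg_infsum_le_0D[OF _ ell2_nth_summable[of u]]) (simp_all add: inner_ell2_self)
    then show "u = 0"
      by (intro ell2_eqI) (simp add: zero_ell2.rep_eq)
  qed (simp add: inner_ell2_self zero_ell2.rep_eq)
  show "norm u = sqrt (inner u u)"
    by (simp add: norm_ell2_def inner_ell2_self)
qed

end

lemma ell2_nth_diff: "ell2_nth (u - v) i = ell2_nth u i - ell2_nth v i"
  unfolding minus_ell2_def plus_ell2.rep_eq uminus_ell2.rep_eq by simp

lemma sum_le_norm_ell2:
  assumes "finite F"
  shows "(\<Sum>i\<in>F. (cmod (ell2_nth u i))\<^sup>2) \<le> (norm u)\<^sup>2"
proof -
  have "(\<Sum>i\<in>F. (cmod (ell2_nth u i))\<^sup>2) \<le> (\<Sum>\<^sub>\<infinity>i. (cmod (ell2_nth u i))\<^sup>2)"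
    by (rule finite_sum_le_infsum[OF ell2_nth_summable assms]) auto
  also have "\<dots> = (norm u)\<^sup>2"
    unfolding inner_ell2_self[symmetric] by (rule power2_norm_eq_inner[symmetric])
  finally show ?thesis .
qed

lemma cmod_ell2_nth_le: "cmod (ell2_nth u i) \<le> norm u"
  by (rule power2_le_imp_le) (use sum_le_norm_ell2[of "{i}" u] in simp_all)

lemma ell2_bounded_partial_sums:
  fixes f :: "'i \<Rightarrow> complex"
  assumes "\<And>F. finite F \<Longrightarrow> (\<Sum>i\<in>F. (cmod (f i))\<^sup>2) \<le> C"
  shows "(\<lambda>i. (cmod (f i))\<^sup>2) summable_on UNIV"
proof (rule nonneg_bounded_partial_sums_imp_summable_on)
  show "eventually (\<lambda>F. (\<Sum>i\<in>F. (cmod (f i))\<^sup>2) \<le> C) (finite_subsets_at_top UNIV)"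
    by (rule eventually_finite_subsets_at_top_weakI) (rule assms)
qed simp

instance ell2 :: (type) banach
proof
  fix X :: "nat \<Rightarrow> 'a ell2"
  assume X: "Cauchy X"
  have "Cauchy (\<lambda>n. ell2_nth (X n) i)" for i
  proof (rule CauchyI)
    fix e :: real assume "e > 0"
    then obtain M where M: "\<And>m n. m \<ge> M \<Longrightarrow> n \<ge> M \<Longrightarrow> norm (X m - X n) < e"
      using CauchyD[OF X] by blast
    have "norm (ell2_nth (X m) i - ell2_nth (X n) i) < e" if "m \<ge> M" "n \<ge> M" for m n
      using cmod_ell2_nth_le[of "X m - X n" i] M[OF that] by (simp add: ell2_nth_diff)
    then show "\<exists>M. \<forall>m\<ge>M. \<forall>n\<ge>M. norm (ell2_nth (X m) i - ell2_nth (X n) i) < e"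
      by blast
  qed
  then have "\<exists>L. \<forall>i. (\<lambda>n. ell2_nth (X n) i) \<longlonglongrightarrow> L i"
    by (intro choice) (auto simp: Cauchy_convergent_iff convergent_def)
  then obtain L where L: "\<And>i. (\<lambda>n. ell2_nth (X n) i) \<longlonglongrightarrow> L i"
    by blast
  have key: "\<exists>M. \<forall>m\<ge>M. \<forall>F. finite F \<longrightarrow>
      (\<Sum>i\<in>F. (cmod (ell2_nth (X m) i - L i))\<^sup>2) \<le> e\<^sup>2" if e: "e > 0" for e :: real
  proof -
    obtain M where M: "\<And>m n. m \<ge> M \<Longrightarrow> n \<ge> M \<Longrightarrow> norm (X m - X n) < e"
      using CauchyD[OF X e] by blast
    have "(\<Sum>i\<in>F. (cmod (ell2_nth (X m) i - L i))\<^sup>2) \<le> e\<^sup>2" if m: "m \<ge> M" and F: "finite F" for m F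
    proof (rule tendsto_upperbound)
      show "(\<lambda>n. \<Sum>i\<in>F. (cmod (ell2_nth (X m) i - ell2_nth (X n) i))\<^sup>2)
          \<longlonglongrightarrow> (\<Sum>i\<in>F. (cmod (ell2_nth (X m) i - L i))\<^sup>2)"
        by (intro tendsto_intros L)
      show "eventually (\<lambda>n. (\<Sum>i\<in>F. (cmod (ell2_nth (X m) i - ell2_nth (X n) i))\<^sup>2) \<le> e\<^sup>2)
          sequentially"
      proof (rule eventually_sequentiallyI[of M])
        fix n assume n: "n \<ge> M"
        have "(\<Sum>i\<in>F. (cmod (ell2_nth (X m - X n) i))\<^sup>2) \<le> (norm (X m - X n))\<^sup>2"
          by (rule sum_le_norm_ell2[OF F])
        also have "\<dots> \<le> e\<^sup>2"
          using M[OF m n] by (intro power_mono) auto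
        finally show "(\<Sum>i\<in>F. (cmod (ell2_nth (X m) i - ell2_nth (X n) i))\<^sup>2) \<le> e\<^sup>2"
          by (simp add: ell2_nth_diff)
      qed
    qed simp
    then show ?thesis by blast
  qed
  obtain M where M: "\<And>F. finite F \<Longrightarrow> (\<Sum>i\<in>F. (cmod (ell2_nth (X M) i - L i))\<^sup>2) \<le> 1\<^sup>2"
    using key[of 1] by auto
  have "(\<lambda>i. (cmod (- (ell2_nth (X M) i - L i)))\<^sup>2) summable_on UNIV"
    unfolding norm_minus_cancel by (rule ell2_bounded_partial_sums[OF M])
  from square_summable_add[OF ell2_nth_summable[of "X M"] this]
  have L2: "ell2_nth (Abs_ell2 L) = L"
    by (intro Abs_ell2_inverse) simp
  have "X \<longlonglongrightarrow> Abs_ell2 L"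
  proof (rule LIMSEQ_I)
    fix r :: real assume r: "r > 0"
    obtain M where M: "\<And>m F. m \<ge> M \<Longrightarrow> finite F \<Longrightarrow>
        (\<Sum>i\<in>F. (cmod (ell2_nth (X m) i - L i))\<^sup>2) \<le> (r/2)\<^sup>2"
      using key[of "r/2"] r by auto
    have "norm (X m - Abs_ell2 L) < r" if "m \<ge> M" for m
    proof -
      have "(\<Sum>\<^sub>\<infinity>i. (cmod (ell2_nth (X m - Abs_ell2 L) i))\<^sup>2) \<le> (r/2)\<^sup>2"
        by (intro infsum_le_finite_sums ell2_nth_summable) (simp add: ell2_nth_diff L2 M that)
      then have "norm (X m - Abs_ell2 L) \<le> sqrt ((r/2)\<^sup>2)"
        unfolding norm_ell2_def by (rule real_sqrt_le_mono)
      then show ?thesis using r by simp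
    qed
    then show "\<exists>M. \<forall>m\<ge>M. norm (X m - Abs_ell2 L) < r" by blast
  qed
  then show "convergent X" by (auto simp: convergent_def)
qed

instantiation ell2 :: (type) complex_hilbert_space
begin

lift_definition scaleC_ell2 :: "complex \<Rightarrow> 'a ell2 \<Rightarrow> 'a ell2" is "\<lambda>z u i. z * u i"
  by (simp add: norm_mult power_mult_distrib summable_on_cmult_right)

definition cinner_ell2 :: "'a ell2 \<Rightarrow> 'a ell2 \<Rightarrow> complex"
  where "cinner_ell2 u v = (\<Sum>\<^sub>\<infinity>i. ell2_nth u i * cnj (ell2_nth v i))"

instance
proof
  fix u v w :: "'a ell2" and z z' :: complex and r :: real
  show "z *\<^sub>C (u + v) = z *\<^sub>C u + z *\<^sub>C v"
    by (rule ell2_eqI) (simp add: scaleC_ell2.rep_eq plus_ell2.rep_eq distrib_left distrib_right)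
  show "(z + z') *\<^sub>C u = z *\<^sub>C u + z' *\<^sub>C u"
    by (rule ell2_eqI) (simp add: scaleC_ell2.rep_eq plus_ell2.rep_eq distrib_left distrib_right)
  show "z *\<^sub>C (z' *\<^sub>C u) = (z * z') *\<^sub>C u"
    by (rule ell2_eqI) (simp add: scaleC_ell2.rep_eq mult.assoc)
  show "r *\<^sub>R u = complex_of_real r *\<^sub>C u"
    by (rule ell2_eqI) (simp add: scaleC_ell2.rep_eq scaleR_ell2.rep_eq scaleR_conv_of_real)
  show "cinner u v = cnj (cinner v u)"
    unfolding cinner_ell2_def infsum_cnj[symmetric] by (simp add: mult.commute)
  show "cinner (u + v) w = cinner u w + cinner v w"
    by (simp add: cinner_ell2_def plus_ell2.rep_eq distrib_right infsum_add ell2_mult_summable)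
  show "cinner (z *\<^sub>C u) v = z * cinner u v"
    by (simp add: cinner_ell2_def scaleC_ell2.rep_eq mult.assoc infsum_cmult_right')
  show "inner u v = Re (cinner u v)"
    by (simp add: inner_ell2_def cinner_ell2_def)
qed

end


section \<open>Periodic Jacobi operators\<close>

definition periodic_seq :: "nat \<Rightarrow> (int \<Rightarrow> real) \<Rightarrow> bool"
  where "periodic_seq p a \<longleftrightarrow> (\<forall>i. a (i + int p) = a i)"

text \<open>
  For bounded (in particular periodic) coefficients the sequence under \<open>Abs_ell2\<close> is
  square-summable, see \<open>ell2_nth_jacobi\<close> and \<open>bounded_clinear_jacobi\<close> below.
\<close>

definition jacobi ::
    "(int \<Rightarrow> real) \<Rightarrow> (int \<Rightarrow> real) \<Rightarrow> (int \<Rightarrow> real) \<Rightarrow> int ell2 \<Rightarrow> int ell2"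
  where "jacobi a b c u = Abs_ell2 (\<lambda>n.
    complex_of_real (c (n - 1)) * ell2_nth u (n - 1)
    + complex_of_real (a n) * ell2_nth u n
    + complex_of_real (b n) * ell2_nth u (n + 1))"

definition omega_a :: "(int \<Rightarrow> real) \<Rightarrow> real"
  where "omega_a a = Max {\<bar>a i - a j\<bar> | i j. i \<ge> 0 \<and> j \<ge> 0}"

definition omega_bc :: "nat \<Rightarrow> (int \<Rightarrow> real) \<Rightarrow> (int \<Rightarrow> real) \<Rightarrow> real"
  where "omega_bc p b c = Max {\<bar>b i - c i\<bar> | i. 0 \<le> i \<and> i < int p}"

lemma periodic_seq_mod:
  assumes "periodic_seq p a"
  shows "a i = a (i mod int p)"
proof -
  have pos: "a (j + int k * int p) = a j" for j k
  proof (induction k)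
    case (Suc k)
    have "a (j + int (Suc k) * int p) = a ((j + int k * int p) + int p)"
      by (simp add: algebra_simps)
    also have "\<dots> = a j"
      using assms Suc unfolding periodic_seq_def by simp
    finally show ?case .
  qed simp
  have "i = i mod int p + (i div int p) * int p"
    by simp
  show ?thesis
  proof (cases "i div int p \<ge> 0")
    case True
    then have "i = i mod int p + int (nat (i div int p)) * int p"
      by simp
    then show ?thesis using pos by metis
  next
    case False
    then have "i mod int p = i + int (nat (- (i div int p))) * int p"
      by (simp add: minus_div_mult_eq_mod[symmetric])
    then show ?thesis using pos by metis
  qed
qed

lemma periodic_seq_range:
  assumes "p \<ge> 1" "periodic_seq p a"
  shows "range a = a ` {0..<int p}"
proof -
  have "a i \<in> a ` {0..<int p}" for i
    using periodic_seq_mod[OF assms(2), of i] assms(1) by (intro image_eqI) auto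
  then show ?thesis by auto
qed

lemma finite_range_periodic_seq: "p \<ge> 1 \<Longrightarrow> periodic_seq p a \<Longrightarrow> finite (range a)"
  by (simp add: periodic_seq_range)

lemma finite_omega_a:
  assumes "p \<ge> 1" "periodic_seq p a"
  shows "finite {\<bar>a i - a j\<bar> | i j. i \<ge> 0 \<and> j \<ge> 0}"
proof (rule finite_subset)
  show "{\<bar>a i - a j\<bar> | i j. i \<ge> 0 \<and> j \<ge> 0} \<subseteq> (\<lambda>(x, y). \<bar>x - y\<bar>) ` (range a \<times> range a)"
    by auto
  show "finite ((\<lambda>(x, y). \<bar>x - y\<bar>) ` (range a \<times> range a))"
    using finite_range_periodic_seq[OF assms] by auto
qed

lemma bounded_coeff:
  fixes f :: "int \<Rightarrow> real"
  assumes "bounded (range f)"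
  obtains C where "\<And>n. cmod (complex_of_real (f n)) \<le> C"
  using assms by (auto simp: bounded_iff)

lemma summable_on_int_shift:
  fixes f :: "int \<Rightarrow> real"
  assumes "f summable_on UNIV"
  shows "(\<lambda>n. f (n + k)) summable_on UNIV"
proof -
  have "bij (\<lambda>n::int. n + k)"
    by (rule bij_betw_byWitness[where f' = "\<lambda>n. n - k"]) auto
  from summable_on_reindex_bij_betw[OF this, of f] assms show ?thesis by simp
qed

lemma ell2_nth_jacobi:
  assumes "bounded (range a)" "bounded (range b)" "bounded (range c)"
  shows "ell2_nth (jacobi a b c u) n =
    complex_of_real (c (n - 1)) * ell2_nth u (n - 1)
    + complex_of_real (a n) * ell2_nth u n
    + complex_of_real (b n) * ell2_nth u (n + 1)"
proof -
  obtain A where A: "\<And>n. cmod (complex_of_real (a n)) \<le> A" using bounded_coeff[OF assms(1)] by blast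
  obtain B where B: "\<And>n. cmod (complex_of_real (b n)) \<le> B" using bounded_coeff[OF assms(2)] by blast
  obtain C where C: "\<And>n. cmod (complex_of_real (c n)) \<le> C" using bounded_coeff[OF assms(3)] by blast
  have "(\<lambda>n. (cmod (ell2_nth u (n + k)))\<^sup>2) summable_on UNIV" for k :: int
    by (rule summable_on_int_shift[OF ell2_nth_summable])
  note this[of "-1"] this[of 0] this[of 1]
  then have "(\<lambda>n. (cmod (complex_of_real (c (n - 1)) * ell2_nth u (n - 1)))\<^sup>2) summable_on UNIV"
    "(\<lambda>n. (cmod (complex_of_real (a n) * ell2_nth u n))\<^sup>2) summable_on UNIV"
    "(\<lambda>n. (cmod (complex_of_real (b n) * ell2_nth u (n + 1)))\<^sup>2) summable_on UNIV"
    using A B C by (auto intro!: square_summable_bounded_mult simp del: norm_of_real)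
  then show ?thesis
    unfolding jacobi_def
    by (subst Abs_ell2_inverse) (auto intro!: square_summable_add)
qed

lemma norm_ell2_shift_bound:
  fixes u v :: "int ell2"
  assumes v: "\<And>n. ell2_nth v n = f n * ell2_nth u (n + k)" and C: "\<And>n. cmod (f n) \<le> C"
  shows "norm v \<le> C * norm u"
proof -
  have C0: "0 \<le> C"
    using C[of 0] norm_ge_zero order_trans by blast
  have bij: "bij (\<lambda>n::int. n + k)"
    by (rule bij_betw_byWitness[where f' = "\<lambda>n. n - k"]) auto
  have s: "(\<lambda>n. (cmod (ell2_nth u (n + k)))\<^sup>2) summable_on UNIV"
    by (rule summable_on_int_shift[OF ell2_nth_summable])
  have "(\<Sum>\<^sub>\<infinity>n. (cmod (ell2_nth v n))\<^sup>2) \<le> (\<Sum>\<^sub>\<infinity>n. C\<^sup>2 * (cmod (ell2_nth u (n + k)))\<^sup>2)"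
  proof (rule infsum_mono)
    show "(\<lambda>n. (cmod (ell2_nth v n))\<^sup>2) summable_on UNIV"
      by (rule ell2_nth_summable)
    show "(\<lambda>n. C\<^sup>2 * (cmod (ell2_nth u (n + k)))\<^sup>2) summable_on UNIV"
      by (rule summable_on_cmult_right[OF s])
    show "(cmod (ell2_nth v n))\<^sup>2 \<le> C\<^sup>2 * (cmod (ell2_nth u (n + k)))\<^sup>2" for n
      unfolding v norm_mult power_mult_distrib
      by (intro mult_right_mono power_mono C) auto
  qed
  also have "\<dots> = C\<^sup>2 * (\<Sum>\<^sub>\<infinity>n. (cmod (ell2_nth u (n + k)))\<^sup>2)"
    by (rule infsum_cmult_right')
  also have "(\<Sum>\<^sub>\<infinity>n. (cmod (ell2_nth u (n + k)))\<^sup>2) = (\<Sum>\<^sub>\<infinity>n. (cmod (ell2_nth u n))\<^sup>2)"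
    by (rule infsum_reindex_bij_betw[OF bij])
  finally have "norm v \<le> sqrt (C\<^sup>2 * (\<Sum>\<^sub>\<infinity>n. (cmod (ell2_nth u n))\<^sup>2))"
    unfolding norm_ell2_def by (rule real_sqrt_le_mono)
  then show ?thesis
    using C0 by (simp add: norm_ell2_def real_sqrt_mult)
qed

lemma bounded_clinear_jacobi:
  assumes "bounded (range a)" "bounded (range b)" "bounded (range c)"
  shows "bounded_clinear (jacobi a b c)"
proof -
  note nth = ell2_nth_jacobi[OF assms]
  obtain A where A: "\<And>n. cmod (complex_of_real (a n)) \<le> A" using bounded_coeff[OF assms(1)] by blast
  obtain B where B: "\<And>n. cmod (complex_of_real (b n)) \<le> B" using bounded_coeff[OF assms(2)] by blast
  obtain C where C: "\<And>n. cmod (complex_of_real (c n)) \<le> C" using bounded_coeff[OF assms(3)] by blast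
  have 0: "bounded (range (\<lambda>_::int. 0::real))"
    by simp
  have b1: "norm (jacobi a b c u) \<le> norm u * (C + A + B)" for u
  proof -
    have split: "jacobi a b c u =
        jacobi (\<lambda>_. 0) (\<lambda>_. 0) c u + jacobi a (\<lambda>_. 0) (\<lambda>_. 0) u + jacobi (\<lambda>_. 0) b (\<lambda>_. 0) u"
      by (rule ell2_eqI) (simp add: plus_ell2.rep_eq nth ell2_nth_jacobi assms 0)
    have "norm (jacobi (\<lambda>_. 0) (\<lambda>_. 0) c u) \<le> C * norm u"
      by (rule norm_ell2_shift_bound[where k = "-1" and f = "\<lambda>n. complex_of_real (c (n - 1))"])
         (simp_all add: ell2_nth_jacobi assms 0 C del: norm_of_real)
    moreover have "norm (jacobi a (\<lambda>_. 0) (\<lambda>_. 0) u) \<le> A * norm u"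
      by (rule norm_ell2_shift_bound[where k = 0 and f = "\<lambda>n. complex_of_real (a n)"])
         (simp_all add: ell2_nth_jacobi assms 0 A del: norm_of_real)
    moreover have "norm (jacobi (\<lambda>_. 0) b (\<lambda>_. 0) u) \<le> B * norm u"
      by (rule norm_ell2_shift_bound[where k = 1 and f = "\<lambda>n. complex_of_real (b n)"])
         (simp_all add: ell2_nth_jacobi assms 0 B del: norm_of_real)
    ultimately have "norm (jacobi (\<lambda>_. 0) (\<lambda>_. 0) c u + jacobi a (\<lambda>_. 0) (\<lambda>_. 0) u
        + jacobi (\<lambda>_. 0) b (\<lambda>_. 0) u) \<le> C * norm u + A * norm u + B * norm u"
      by (intro norm_triangle_le add_mono norm_triangle_mono)
    then show ?thesis
      unfolding split[symmetric] by (simp add: algebra_simps)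
  qed
  have "bounded_linear (jacobi a b c)"
    by (rule bounded_linear_intro[OF _ _ b1])
       (auto intro!: ell2_eqI simp: nth plus_ell2.rep_eq scaleR_ell2.rep_eq
          algebra_simps scaleR_conv_of_real)
  moreover have "jacobi a b c (z *\<^sub>C u) = z *\<^sub>C jacobi a b c u" for z u
    by (rule ell2_eqI) (simp add: nth scaleC_ell2.rep_eq algebra_simps)
  ultimately show ?thesis by (simp add: bounded_clinear_def)
qed

lemma bounded_periodic_seq: "p \<ge> 1 \<Longrightarrow> periodic_seq p a \<Longrightarrow> bounded (range a)"
  by (rule finite_imp_bounded[OF finite_range_periodic_seq])

end

theory Submission
  imports Defs
begin

text \<open>
  Split \<open>J = S + D\<close> with \<open>S\<close> the symmetric Jacobi operator with off-diagonal entries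
  \<open>(b + c) / 2\<close> and \<open>norm D \<le> \<omega>\<close>, where \<open>\<omega>\<close> is \<open>omega_bc p b c\<close>. For a site \<open>i\<close>, delete all sites
  congruent to \<open>i\<close> modulo \<open>p\<close>: the remaining operator is a direct sum of copies of one symmetric
  matrix of size \<open>p - 1\<close>, with eigenvalues \<open>\<nu>(i, k)\<close>. Comparing traces,
  \<open>a i - a j\<close> is the sum over \<open>k\<close> of \<open>\<nu>(j, k) - \<nu>(i, k)\<close>, so it is enough to bound each of
  these \<open>p - 1\<close> differences by \<open>2 * (\<epsilon> + \<omega>)\<close>.

  The open interval from \<open>\<nu>(i, k)\<close> to \<open>\<nu>(j, k)\<close> is a spectral gap of \<open>S\<close>: per period, the form of
  \<open>S\<close> is at most \<open>\<nu>(i, k)\<close> on a space \<open>X\<close> and at least \<open>\<nu>(j, k)\<close> on a space \<open>Y\<close> whose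
  dimensions add up to \<open>p\<close>, so that \<open>X\<close> and \<open>Y\<close> together fill up the whole space. If the gap is
  longer than \<open>2 * (\<epsilon> + \<omega>)\<close>, the vertical line through its midpoint avoids the pseudospectrum of
  \<open>J\<close>. As \<open>\<epsilon> \<ge> \<omega>\<close>, the extreme points of the spectrum of \<open>S\<close> belong to the pseudospectrum of
  \<open>J\<close>, and they lie on different sides of this line, which contradicts connectedness.
\<close>

section \<open>Quadratic forms on real inner product spaces\<close>

definition orthonormal :: "'a::real_inner set \<Rightarrow> bool"
  where "orthonormal F \<longleftrightarrow> pairwise orthogonal F \<and> (\<forall>f\<in>F. norm f = 1)"

lemma orthonormal_independent: "orthonormal F \<Longrightarrow> independent F"
  unfolding orthonormal_def by (rule pairwise_orthogonal_independent) auto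

lemma orthonormal_inner:
  assumes "orthonormal F" "f \<in> F" "g \<in> F"
  shows "inner f g = (if f = g then 1 else 0)"
  using assms unfolding orthonormal_def pairwise_def orthogonal_def
  by (auto simp flip: power2_norm_eq_inner)

lemma orthonormal_expansion:
  assumes "finite F" "orthonormal F" "x \<in> span F"
  shows "x = (\<Sum>f\<in>F. inner x f *\<^sub>R f)"
proof -
  obtain t where t: "x = (\<Sum>f\<in>F. t f *\<^sub>R f)"
    using assms(1,3) by (auto simp: span_finite)
  have "inner x g = t g" if "g \<in> F" for g
  proof -
    have "inner x g = (\<Sum>f\<in>F. t f * (if f = g then 1 else 0))"
      unfolding t inner_sum_left inner_scaleR_left
      by (intro sum.cong refl arg_cong2[where f = "(*)"] orthonormal_inner[OF assms(2)] that)
    also have "\<dots> = t g"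
      using assms(1) that by (simp add: if_distrib[of "(*) _"] cong: if_cong)
    finally show ?thesis .
  qed
  then have "(\<Sum>f\<in>F. inner x f *\<^sub>R f) = (\<Sum>f\<in>F. t f *\<^sub>R f)"
    by (intro sum.cong) auto
  with t show ?thesis by simp
qed

text \<open>Only the form is diagonal on \<open>F\<close>: the vectors \<open>A f\<close> may leave
  \<open>span F\<close>. Hence the result applies to families that diagonalize a compression of
  \<open>A\<close> and not \<open>A\<close> itself.\<close>

lemma quadratic_form_sum:
  fixes A :: "'a::real_inner \<Rightarrow> 'a"
  assumes "finite F" "linear A" "pairwise (\<lambda>f g. inner (A f) g = 0) F"
    and x: "x = (\<Sum>f\<in>F. t f *\<^sub>R f)"
  shows "inner (A x) x = (\<Sum>f\<in>F. (t f)\<^sup>2 * inner (A f) f)"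
proof -
  have "A x = (\<Sum>f\<in>F. t f *\<^sub>R A f)"
    unfolding x by (simp add: linear_sum[OF assms(2)] linear_cmul[OF assms(2)])
  then have "inner (A x) x = (\<Sum>f\<in>F. t f * inner (A f) x)"
    by (simp add: inner_sum_left)
  also have "\<dots> = (\<Sum>f\<in>F. \<Sum>g\<in>F. t f * (t g * inner (A f) g))"
    unfolding x by (simp add: inner_sum_right sum_distrib_left)
  also have "\<dots> = (\<Sum>f\<in>F. \<Sum>g\<in>F. if f = g then (t f)\<^sup>2 * inner (A f) f else 0)"
    using assms(3) by (intro sum.cong refl) (auto simp: pairwise_def power2_eq_square)
  finally show ?thesis
    using assms(1) by simp
qed

lemma norm_sum_orthonormal:
  assumes "finite F" "orthonormal F" "x = (\<Sum>f\<in>F. t f *\<^sub>R f)"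
  shows "(norm x)\<^sup>2 = (\<Sum>f\<in>F. (t f)\<^sup>2)"
proof -
  have "inner (id x) x = (\<Sum>f\<in>F. (t f)\<^sup>2 * inner (id f) f)"
    using assms by (intro quadratic_form_sum)
      (auto simp: orthonormal_def pairwise_def orthogonal_def module_hom_id[unfolded id_def])
  also have "\<dots> = (\<Sum>f\<in>F. (t f)\<^sup>2)"
    using assms(2) by (intro sum.cong refl) (simp add: orthonormal_inner)
  finally show ?thesis
    by (simp add: power2_norm_eq_inner)
qed

lemma quadratic_form_le_on_span:
  fixes A :: "'a::real_inner \<Rightarrow> 'a"
  assumes "finite F" "orthonormal F" "linear A" "pairwise (\<lambda>f g. inner (A f) g = 0) F"
    and le: "\<And>f. f \<in> F \<Longrightarrow> inner (A f) f \<le> C" and x: "x \<in> span F"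
  shows "inner (A x) x \<le> C * (norm x)\<^sup>2"
proof -
  obtain t where t: "x = (\<Sum>f\<in>F. t f *\<^sub>R f)"
    using assms(1) x by (auto simp: span_finite)
  have "(\<Sum>f\<in>F. (t f)\<^sup>2 * inner (A f) f) \<le> (\<Sum>f\<in>F. (t f)\<^sup>2 * C)"
    by (intro sum_mono mult_left_mono le) auto
  also have "\<dots> = C * (norm x)\<^sup>2"
    unfolding norm_sum_orthonormal[OF assms(1,2) t] by (simp add: sum_distrib_left mult.commute)
  finally show ?thesis
    unfolding quadratic_form_sum[OF assms(1,3,4) t] .
qed

lemma quadratic_form_ge_on_span:
  fixes A :: "'a::real_inner \<Rightarrow> 'a"
  assumes "finite F" "orthonormal F" "linear A" "pairwise (\<lambda>f g. inner (A f) g = 0) F"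
    and "\<And>f. f \<in> F \<Longrightarrow> C \<le> inner (A f) f" and "x \<in> span F"
  shows "C * (norm x)\<^sup>2 \<le> inner (A x) x"
  using quadratic_form_le_on_span[of F "\<lambda>x. - A x" "- C" x] assms linear_compose_neg[OF assms(3)]
  by (simp add: pairwise_def)

text \<open>The bound comes from testing \<open>A (x + y)\<close> against \<open>y - x\<close>, where the cross terms cancel.\<close>

lemma norm_ge_of_definite_splitting:
  fixes A :: "'a::real_inner \<Rightarrow> 'a"
  assumes "linear A" and sym: "inner (A x) y = inner x (A y)" and "d \<ge> 0"
    and neg: "inner (A x) x \<le> - d * (norm x)\<^sup>2" and pos: "d * (norm y)\<^sup>2 \<le> inner (A y) y"
  shows "d * norm (x + y) \<le> norm (A (x + y))"
\<comment> \<open>The factor \<open>norm (y - x)\<close> is cancelled at the end. If it vanishes,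
  the two sign conditions on the same vector leave only
  \<open>d * (norm x)\<^sup>2 = 0\<close>.\<close>
proof (cases "x = y")
  case True
  then have "d * (norm x)\<^sup>2 \<le> - d * (norm x)\<^sup>2"
    using neg pos by simp
  moreover have "0 \<le> d * (norm x)\<^sup>2"
    using \<open>d \<ge> 0\<close> by simp
  ultimately have "d * (norm x)\<^sup>2 = 0"
    by linarith
  then show ?thesis
    using True by auto
next
  case False
  have "inner (A (x + y)) (y - x) = inner (A y) y - inner (A x) x"
    using sym by (simp add: linear_add[OF assms(1)] inner_simps inner_commute)
  then have "d * ((norm x)\<^sup>2 + (norm y)\<^sup>2) \<le> inner (A (x + y)) (y - x)"
    using neg pos by (simp add: algebra_simps)
  also have "\<dots> \<le> norm (A (x + y)) * norm (y - x)"
    by (rule norm_cauchy_schwarz)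
  finally have *: "d * ((norm x)\<^sup>2 + (norm y)\<^sup>2) \<le> norm (A (x + y)) * norm (y - x)" .
  \<comment> \<open>The parallelogram law and the inequality of arithmetic and geometric means bring
    in the product \<open>norm (x + y) * norm (y - x)\<close>.\<close>
  have "2 * ((norm x)\<^sup>2 + (norm y)\<^sup>2) = (norm (x + y))\<^sup>2 + (norm (y - x))\<^sup>2"
    by (simp add: power2_norm_eq_inner inner_simps inner_commute)
  also have "\<dots> \<ge> 2 * norm (x + y) * norm (y - x)"
    by (rule sum_squares_bound)
  finally have "norm (x + y) * norm (y - x) \<le> (norm x)\<^sup>2 + (norm y)\<^sup>2"
    by simp
  then have "d * (norm (x + y) * norm (y - x)) \<le> d * ((norm x)\<^sup>2 + (norm y)\<^sup>2)"
    using \<open>d \<ge> 0\<close> by (rule mult_left_mono)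
  with * have "d * norm (x + y) * norm (y - x) \<le> norm (A (x + y)) * norm (y - x)"
    by (simp add: mult.assoc)
  then show ?thesis
    using False by simp
qed

section \<open>Diagonalizing a compression by successive maximization\<close>

text \<open>The ambient space may have infinite dimension, so closed bounded sets need not be
  compact. Here a compact set is built one generator at a time, as a continuous image of an interval
  times the previous set. It contains the unit sphere of \<open>span E\<close> when \<open>E\<close>
  is orthonormal.\<close>

lemma compact_superset_of_combinations:
  fixes E :: "'a::real_normed_vector set"
  assumes "finite E"
  obtains K where "compact K" "K \<subseteq> span E"
    "\<And>t. (\<And>e. e \<in> E \<Longrightarrow> \<bar>t e\<bar> \<le> 1) \<Longrightarrow> (\<Sum>e\<in>E. t e *\<^sub>R e) \<in> K"
  using assms
proof (induction E arbitrary: thesis rule: finite_induct)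
  case empty
  show ?case by (rule empty[of "{0}"]) auto
next
  case (insert e E)
  obtain K where K: "compact K" "K \<subseteq> span E"
    "\<And>t. (\<And>e. e \<in> E \<Longrightarrow> \<bar>t e\<bar> \<le> 1) \<Longrightarrow> (\<Sum>e\<in>E. t e *\<^sub>R e) \<in> K"
    using insert.IH by blast
  let ?g = "\<lambda>(r, x). r *\<^sub>R e + x"
  show ?case
  proof (rule insert.prems)
    show "compact (?g ` ({-1..1::real} \<times> K))"
      unfolding case_prod_beta
      by (intro compact_continuous_image compact_Times K continuous_intros) auto
    show "?g ` ({-1..1} \<times> K) \<subseteq> span (insert e E)"
    proof clarsimp
      fix r :: real and x assume "x \<in> K"
      then have "x \<in> span (insert e E)"
        using K(2) span_mono[OF subset_insertI] by blast
      then show "r *\<^sub>R e + x \<in> span (insert e E)"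
        by (intro span_add span_scale) (auto intro: span_base)
    qed
    fix t assume t: "\<And>e'. e' \<in> insert e E \<Longrightarrow> \<bar>t e'\<bar> \<le> (1::real)"
    have "(\<Sum>e\<in>insert e E. t e *\<^sub>R e) = ?g (t e, \<Sum>e\<in>E. t e *\<^sub>R e)"
      using insert.hyps by simp
    moreover have "\<bar>t e\<bar> \<le> 1" "(\<Sum>e\<in>E. t e *\<^sub>R e) \<in> K"
      by (rule t, simp) (rule K(3), rule t, simp)
    then have "(t e, \<Sum>e\<in>E. t e *\<^sub>R e) \<in> {-1..1} \<times> K"
      by auto
    ultimately show "(\<Sum>e\<in>insert e E. t e *\<^sub>R e) \<in> ?g ` ({-1..1} \<times> K)"
      by blast
  qed
qed

text \<open>One step of the variational construction of eigenvectors: the form attains its maximum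
  on the compact set of admissible unit vectors, and homogeneity extends the bound to all lengths.
  The cardinality assumption ensures that an admissible unit vector exists.\<close>

lemma exists_max_quadratic_form:
  fixes A :: "'a::real_inner \<Rightarrow> 'a"
  assumes A: "bounded_linear A" and E: "finite E" "orthonormal E"
    and F: "finite F" "orthonormal F" "F \<subseteq> span E" "card F < card E"
  obtains g where "g \<in> span E" "norm g = 1" "\<And>h. h \<in> F \<Longrightarrow> inner g h = 0"
    "\<And>x. x \<in> span E \<Longrightarrow> (\<And>h. h \<in> F \<Longrightarrow> inner x h = 0) \<Longrightarrow>
      inner (A x) x \<le> inner (A g) g * (norm x)\<^sup>2"
proof -
  obtain K where K: "compact K" "K \<subseteq> span E"
    "\<And>t. (\<And>e. e \<in> E \<Longrightarrow> \<bar>t e\<bar> \<le> 1) \<Longrightarrow> (\<Sum>e\<in>E. t e *\<^sub>R e) \<in> K"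
    using compact_superset_of_combinations[OF E(1)] by blast
  define V where "V = {x. \<forall>h\<in>F. inner x h = 0}"
  have unitK: "x \<in> K" if "x \<in> span E" "norm x = 1" for x
  proof -
    have "\<bar>inner x e\<bar> \<le> 1" if "e \<in> E" for e
      using Cauchy_Schwarz_ineq2[of x e] \<open>norm x = 1\<close> E(2) that by (simp add: orthonormal_def)
    then show ?thesis
      using K(3)[of "inner x"] orthonormal_expansion[OF E that(1)] by simp
  qed
  have scaleV: "r *\<^sub>R x \<in> V" if "x \<in> V" for r x
    using that by (simp add: V_def)
  define C where "C = K \<inter> {x. norm x = 1} \<inter> V"
  have "closed V"
  proof -
    have "V = (\<Inter>h\<in>F. {x. inner x h = 0})" by (auto simp: V_def)
    then show ?thesis by (auto intro!: closed_INT closed_Collect_eq continuous_intros)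
  qed
  then have "compact C"
    unfolding C_def using K(1) by (intro compact_Int_closed closed_Collect_eq continuous_intros)
  have normalize: "(1 / norm x) *\<^sub>R x \<in> C" if "x \<in> span E" "x \<in> V" "x \<noteq> 0" for x
    using that by (auto simp: C_def span_scale intro!: unitK scaleV)
  \<comment> \<open>Some \<open>e\<close> in \<open>E\<close> escapes \<open>span F\<close>. Its
    Gram-Schmidt remainder is a nonzero vector of \<open>span E\<close> orthogonal to
    \<open>F\<close>.\<close>
  have "\<not> E \<subseteq> span F"
    using independent_span_bound[OF F(1) orthonormal_independent[OF E(2)]] F(4) by auto
  then obtain e where e: "e \<in> E" "e \<notin> span F" by blast
  define x where "x = e - (\<Sum>f\<in>F. inner e f *\<^sub>R f)"
  have "inner x h = 0" if h: "h \<in> F" for h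
  proof -
    have "(\<Sum>f\<in>F. inner e f * inner f h) = (\<Sum>f\<in>F. inner e f * (if f = h then 1 else 0))"
      by (intro sum.cong refl arg_cong2[where f = "(*)"] orthonormal_inner[OF F(2)] h)
    then show ?thesis
      using F(1) h by (simp add: x_def inner_diff_left inner_sum_left if_distrib[of "(*) _"] cong: if_cong)
  qed
  then have "x \<in> V" by (simp add: V_def)
  moreover have "x \<in> span E"
    unfolding x_def using e(1) F(3) by (intro span_diff span_sum span_scale) (auto intro: span_base)
  moreover have "x \<noteq> 0"
  proof
    assume "x = 0"
    then have "e = (\<Sum>f\<in>F. inner e f *\<^sub>R f)" by (simp add: x_def)
    also have "\<dots> \<in> span F" by (intro span_sum span_scale span_base)
    finally show False using e(2) by simp
  qed
  ultimately have "C \<noteq> {}" using normalize by blast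
  moreover have "continuous_on C (\<lambda>x. inner (A x) x)"
    by (intro continuous_intros linear_continuous_on A)
  ultimately obtain g where g: "g \<in> C" "\<And>x. x \<in> C \<Longrightarrow> inner (A x) x \<le> inner (A g) g"
    using continuous_attains_sup[OF \<open>compact C\<close>] by blast
  show thesis
  proof
    show "g \<in> span E" "norm g = 1" "\<And>h. h \<in> F \<Longrightarrow> inner g h = 0"
      using g(1) K(2) by (auto simp: C_def V_def)
    fix x assume x: "x \<in> span E" "\<And>h. h \<in> F \<Longrightarrow> inner x h = 0"
    show "inner (A x) x \<le> inner (A g) g * (norm x)\<^sup>2"
    proof (cases "x = 0")
      case True
      then show ?thesis using linear_0[OF bounded_linear.linear[OF A]] by simp
    next
      case False
      have "inner (A ((1 / norm x) *\<^sub>R x)) ((1 / norm x) *\<^sub>R x) \<le> inner (A g) g"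
        using x False by (intro g(2) normalize) (auto simp: V_def)
      then have "inner (A x) x / (norm x)\<^sup>2 \<le> inner (A g) g"
        by (simp add: linear_cmul[OF bounded_linear.linear[OF A]] power2_eq_square)
      then show ?thesis
        using False by (simp add: divide_le_eq)
    qed
  qed
qed

text \<open>First-order condition at a maximizer: moving \<open>g\<close> by a small multiple of
  \<open>y\<close> changes the form to first order by \<open>inner (A g) y\<close>, but changes the
  norm only to second order.\<close>

lemma max_quadratic_form_orthogonal:
  fixes A :: "'a::real_inner \<Rightarrow> 'a"
  assumes A: "linear A" and sym: "inner (A y) g = inner y (A g)" and "norm g = 1" "inner g y = 0"
    and max: "\<And>t. inner (A (g + t *\<^sub>R y)) (g + t *\<^sub>R y)
      \<le> inner (A g) g * (norm (g + t *\<^sub>R y))\<^sup>2"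
  shows "inner (A g) y = 0"
proof (rule ccontr)
  assume q: "inner (A g) y \<noteq> 0"
  define q where "q = inner (A g) y"
  define c where "c = inner (A g) g * inner y y - inner (A y) y"
  \<comment> \<open>Maximality gives \<open>2 * t * q \<le> t\<^sup>2 * c\<close> for all
    \<open>t\<close>. At \<open>t = s * q\<close> this becomes \<open>2 \<le> s * c\<close>, while
    this choice of \<open>s\<close> makes \<open>s * c \<le> 1\<close>.\<close>
  define s where "s = 1 / (\<bar>c\<bar> + 1)"
  have gg: "inner g g = 1"
    using \<open>norm g = 1\<close> by (simp flip: power2_norm_eq_inner)
  have s0: "s > 0" by (simp add: s_def)
  have "2 * t * q \<le> t\<^sup>2 * c" for t
  proof -
    have "inner (A (g + t *\<^sub>R y)) (g + t *\<^sub>R y)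
        = inner (A g) g + 2 * t * q + t\<^sup>2 * inner (A y) y"
      using sym by (simp add: linear_add[OF A] linear_cmul[OF A] inner_simps q_def
          inner_commute[of y] power2_eq_square algebra_simps)
    moreover have "(norm (g + t *\<^sub>R y))\<^sup>2 = 1 + t\<^sup>2 * inner y y"
      using \<open>inner g y = 0\<close> gg
      unfolding power2_norm_eq_inner
      by (simp add: inner_simps inner_commute[of y g] power2_eq_square)
    ultimately show ?thesis
      using max[of t] by (simp add: c_def algebra_simps)
  qed
  from this[of "s * q"] have "2 * s * q\<^sup>2 \<le> s * (s * c) * q\<^sup>2"
    by (simp add: power2_eq_square mult_ac)
  moreover have "q\<^sup>2 > 0"
    using q by (simp add: q_def)
  ultimately have "2 * s \<le> s * (s * c)"
    by (simp only: mult_le_cancel_right_pos)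
  then have "2 \<le> s * c" using s0 by simp
  moreover have "c \<le> \<bar>c\<bar> + 1" by linarith
  then have "s * c \<le> 1"
    unfolding s_def by (simp add: divide_le_eq)
  ultimately show False by simp
qed

text \<open>The spectral theorem for the compression of \<open>A\<close> to \<open>span E\<close>,
  obtained by greedy maximization, which also sorts the eigenvalues in decreasing order. The last
  clause is the invariance of the trace under a change of orthonormal basis.\<close>

lemma diagonalizing_sequence:
  fixes A :: "'a::real_inner \<Rightarrow> 'a"
  assumes A: "bounded_linear A" and sym: "\<And>x y. inner (A x) y = inner x (A y)"
    and E: "finite E" "orthonormal E" "card E = n"
  obtains f where "\<And>s. s < n \<Longrightarrow> f s \<in> span E" "\<And>s. s < n \<Longrightarrow> norm (f s) = 1"
    "\<And>s t. s < n \<Longrightarrow> t < n \<Longrightarrow> s \<noteq> t \<Longrightarrow> inner (f s) (f t) = 0"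
    "\<And>s t. s < n \<Longrightarrow> t < n \<Longrightarrow> s \<noteq> t \<Longrightarrow> inner (A (f s)) (f t) = 0"
    "\<And>s t. s \<le> t \<Longrightarrow> t < n \<Longrightarrow> inner (A (f t)) (f t) \<le> inner (A (f s)) (f s)"
    "(\<Sum>s<n. inner (A (f s)) (f s)) = (\<Sum>e\<in>E. inner (A e) e)"
proof -
  note linA = bounded_linear.linear[OF A]
  \<comment> \<open>The last clause keeps maximality over everything orthogonal to the earlier
    vectors. Both the vanishing off-diagonal entries and the ordering are read off from it.\<close>
  define P where "P m f \<longleftrightarrow> (\<forall>s<m. f s \<in> span E \<and> norm (f s) = 1) \<and>
      (\<forall>s<m. \<forall>t<s. inner (f s) (f t) = 0) \<and>
      (\<forall>s<m. \<forall>x\<in>span E. (\<forall>t<s. inner x (f t) = 0) \<longrightarrow>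
        inner (A x) x \<le> inner (A (f s)) (f s) * (norm x)\<^sup>2)" for m and f :: "nat \<Rightarrow> 'a"
  have orth: "inner (f s) (f t) = 0" if "P m f" "s < m" "t < m" "s \<noteq> t" for m f s t
  proof -
    have *: "\<forall>s<m. \<forall>t<s. inner (f s) (f t) = 0"
      using that(1) by (simp add: P_def)
    show ?thesis
    proof (cases "s < t")
      case True
      then have "inner (f t) (f s) = 0" using * that(3) by blast
      then show ?thesis by (simp add: inner_commute)
    next
      case False
      then have "t < s" using that(4) by simp
      then show ?thesis using * that(2) by blast
    qed
  qed
  have inj: "inj_on f {..<m}" if "P m f" for m f
  proof (rule inj_onI, rule ccontr)
    fix s t assume "s \<in> {..<m}" "t \<in> {..<m}" "f s = f t" "s \<noteq> t"
    then have "inner (f s) (f s) = 0" "norm (f s) = 1"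
      using orth[OF that, of s t] that by (auto simp: P_def)
    then show False by simp
  qed
  have on: "orthonormal (f ` {..<m})" if "P m f" for m f
    using orth[OF that] that
    by (auto simp: orthonormal_def pairwise_def orthogonal_def P_def)
  have "\<exists>f. P m f" if "m \<le> n" for m
    using that
  proof (induction m)
    case 0
    show ?case by (simp add: P_def)
  next
    case (Suc m)
    then obtain f where f: "P m f" by auto
    have "card (f ` {..<m}) < card E"
      using card_image[OF inj[OF f]] Suc.prems E(3) by simp
    moreover have "f ` {..<m} \<subseteq> span E"
      using f by (auto simp: P_def)
    ultimately obtain g where g: "g \<in> span E" "norm g = 1"
      "\<And>h. h \<in> f ` {..<m} \<Longrightarrow> inner g h = 0"
      "\<And>x. x \<in> span E \<Longrightarrow> (\<And>h. h \<in> f ` {..<m} \<Longrightarrow> inner x h = 0) \<Longrightarrow>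
        inner (A x) x \<le> inner (A g) g * (norm x)\<^sup>2"
      using exists_max_quadratic_form[OF A E(1,2) _ on[OF f]] by blast
    have "\<forall>x\<in>span E. (\<forall>t<m. inner x (f t) = 0) \<longrightarrow> inner (A x) x \<le> inner (A g) g * (norm x)\<^sup>2"
      by (intro ballI impI g(4)) auto
    then have "P (Suc m) (f(m := g))"
      using f g(1-3) unfolding P_def
      by (auto simp: less_Suc_eq all_conj_distrib)
    then show ?case by blast
  qed
  then obtain f where f: "P n f" by blast
  have span: "f s \<in> span E" and unit: "norm (f s) = 1"
    and max: "x \<in> span E \<Longrightarrow> (\<And>t. t < s \<Longrightarrow> inner x (f t) = 0) \<Longrightarrow>
        inner (A x) x \<le> inner (A (f s)) (f s) * (norm x)\<^sup>2" if "s < n" for s x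
    using f that by (auto simp: P_def)
  have less: "inner (A (f s)) (f t) = 0" if "s < t" "t < n" for s t
  proof (rule max_quadratic_form_orthogonal[OF linA sym])
    show "norm (f s) = 1" "inner (f s) (f t) = 0"
      using that by (simp_all add: unit orth[OF f])
    fix r
    show "inner (A (f s + r *\<^sub>R f t)) (f s + r *\<^sub>R f t)
        \<le> inner (A (f s)) (f s) * (norm (f s + r *\<^sub>R f t))\<^sup>2"
    proof (rule max)
      show "f s + r *\<^sub>R f t \<in> span E"
        using that by (intro span_add span_scale span) auto
      show "inner (f s + r *\<^sub>R f t) (f t') = 0" if "t' < s" for t'
        using that \<open>s < t\<close> \<open>t < n\<close> by (simp add: inner_simps orth[OF f])
    qed (use that in simp)
  qed
  have diag: "inner (A (f s)) (f t) = 0" if "s < n" "t < n" "s \<noteq> t" for s t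
  proof (cases "s < t")
    case True
    then show ?thesis using less that by blast
  next
    case False
    then have "inner (A (f t)) (f s) = 0" using less that by simp
    then show ?thesis using sym[of "f s" "f t"] by (simp add: inner_commute)
  qed
  let ?F = "f ` {..<n}"
  have F: "finite ?F" "orthonormal ?F" using on[OF f] by auto
  \<comment> \<open>Otherwise \<open>e\<close> and the \<open>n\<close> vectors of the sequence
    would be \<open>n + 1\<close> independent vectors in a span of dimension
    \<open>n\<close>.\<close>
  have E_span: "e \<in> span ?F" if e: "e \<in> E" for e
  proof (rule ccontr)
    assume "e \<notin> span ?F"
    then have "independent (insert e ?F)"
      using orthonormal_independent[OF F(2)] by (rule independent_insertI)
    moreover have "insert e ?F \<subseteq> span E"
      using e by (auto intro: span span_base)
    ultimately have "card (insert e ?F) \<le> n"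
      using independent_span_bound[OF E(1), of "insert e ?F"] E(3) by simp
    moreover have "e \<notin> ?F" using \<open>e \<notin> span ?F\<close> span_base[of e ?F] by metis
    ultimately show False
      using card_image[OF inj[OF f]] card_insert_disjoint[OF F(1), of e] by simp
  qed
  have "pairwise (\<lambda>f g. inner (A f) g = 0) ?F"
    using diag by (auto simp: pairwise_def)
  then have "inner (A e) e = (\<Sum>s<n. (inner e (f s))\<^sup>2 * inner (A (f s)) (f s))" if "e \<in> E" for e
    using quadratic_form_sum[OF F(1) linA _ orthonormal_expansion[OF F E_span[OF that]]]
    unfolding sum.reindex[OF inj[OF f]] by simp
  then have "(\<Sum>e\<in>E. inner (A e) e) =
      (\<Sum>e\<in>E. \<Sum>s<n. (inner e (f s))\<^sup>2 * inner (A (f s)) (f s))"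
    by (rule sum.cong[OF refl])
  \<comment> \<open>After exchanging the sums, the inner one is the squared norm of
    \<open>f s\<close> in the basis \<open>E\<close>, which is 1.\<close>
  also have "\<dots> = (\<Sum>s<n. (\<Sum>e\<in>E. (inner (f s) e)\<^sup>2) * inner (A (f s)) (f s))"
    by (subst sum.swap) (simp add: sum_distrib_right inner_commute)
  also have "\<dots> = (\<Sum>s<n. inner (A (f s)) (f s))"
  proof (intro sum.cong refl)
    fix s assume "s \<in> {..<n}"
    then have "(\<Sum>e\<in>E. (inner (f s) e)\<^sup>2) = 1"
      using norm_sum_orthonormal[OF E(1,2) orthonormal_expansion[OF E(1,2) span[of s]]] unit[of s]
      by simp
    then show "(\<Sum>e\<in>E. (inner (f s) e)\<^sup>2) * inner (A (f s)) (f s) = inner (A (f s)) (f s)"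
      by simp
  qed
  finally have trace: "(\<Sum>s<n. inner (A (f s)) (f s)) = (\<Sum>e\<in>E. inner (A e) e)" by simp
  have mono: "inner (A (f t)) (f t) \<le> inner (A (f s)) (f s)" if "s \<le> t" "t < n" for s t
  proof (cases "s = t")
    case False
    have "inner (A (f t)) (f t) \<le> inner (A (f s)) (f s) * (norm (f t))\<^sup>2"
    proof (rule max)
      show "inner (f t) (f t') = 0" if "t' < s" for t'
        using that \<open>s \<le> t\<close> \<open>t < n\<close> by (intro orth[OF f]) auto
    qed (use that span in auto)
    then show ?thesis using unit[OF that(2)] by simp
  qed simp
  show thesis
    by (rule that[OF span unit orth[OF f] diag mono trace])
qed

section \<open>Approximate eigenvalues and pseudospectra\<close>

lemma independent_disjoint_union:
  fixes F G :: "'a::real_vector set"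
  assumes fin: "finite F" "finite G" and ind: "independent F" "independent G"
    and "span F \<inter> span G = {0}"
  shows "independent (F \<union> G)" "F \<inter> G = {}"
proof -
  have "x \<notin> F \<inter> G" for x
  proof
    assume x: "x \<in> F \<inter> G"
    then have "x \<in> span F \<inter> span G"
      using span_base by blast
    then have "x = 0" using assms(5) by simp
    with x ind(1) show False
      using dependent_zero by blast
  qed
  then show disj: "F \<inter> G = {}" by blast
  show "independent (F \<union> G)"
  proof (rule independent_if_scalars_zero)
    fix t x assume "(\<Sum>v\<in>F \<union> G. t v *\<^sub>R v) = 0" and x: "x \<in> F \<union> G"
    then have *: "(\<Sum>v\<in>F. t v *\<^sub>R v) = - (\<Sum>v\<in>G. t v *\<^sub>R v)"
      by (simp add: sum.union_disjoint[OF fin disj] eq_neg_iff_add_eq_0)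
    have "(\<Sum>v\<in>F. t v *\<^sub>R v) \<in> span F" "(\<Sum>v\<in>G. t v *\<^sub>R v) \<in> span G"
      by (intro span_sum span_scale, erule span_base)+
    then have "(\<Sum>v\<in>F. t v *\<^sub>R v) \<in> span F \<inter> span G"
      using * by (simp add: span_neg)
    then have "(\<Sum>v\<in>F. t v *\<^sub>R v) = 0" "(\<Sum>v\<in>G. t v *\<^sub>R v) = 0"
      using * assms(5) by auto
    then show "t x = 0"
      using x independentD[OF ind(1) fin(1) subset_refl] independentD[OF ind(2) fin(2) subset_refl]
      by blast
  qed (use fin in simp)
qed

text \<open>Pythagoras is applied to \<open>v\<close> and to \<open>A v\<close>; orthogonality of
  the images is what lets a common stretch factor survive linear combinations.\<close>

lemma norm_image_orthogonal_span:
  fixes A :: "'a::real_inner \<Rightarrow> 'a"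
  assumes W: "finite W" "pairwise orthogonal W" "pairwise (\<lambda>u v. orthogonal (A u) (A v)) W"
    and A: "linear A" and norm: "\<And>w. w \<in> W \<Longrightarrow> norm (A w) = k * norm w"
    and "k \<ge> 0" and v: "v \<in> span W"
  shows "norm (A v) = k * norm v"
proof -
  obtain t where t: "v = (\<Sum>w\<in>W. t w *\<^sub>R w)"
    using W(1) v by (auto simp: span_finite)
  have *: "(norm v)\<^sup>2 = (\<Sum>w\<in>W. (norm (t w *\<^sub>R w))\<^sup>2)"
    unfolding t using W by (intro norm_sum_Pythagorean) (auto simp: pairwise_def orthogonal_clauses)
  have "(norm (A v))\<^sup>2 = (\<Sum>w\<in>W. (norm (t w *\<^sub>R A w))\<^sup>2)"
    unfolding t linear_sum[OF A] linear_cmul[OF A]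
    using W by (intro norm_sum_Pythagorean) (auto simp: pairwise_def orthogonal_clauses)
  also have "\<dots> = (\<Sum>w\<in>W. k\<^sup>2 * (norm (t w *\<^sub>R w))\<^sup>2)"
    by (intro sum.cong refl) (simp add: norm power_mult_distrib)
  also have "\<dots> = (k * norm v)\<^sup>2"
    by (simp only: * power_mult_distrib flip: sum_distrib_left)
  finally have "(norm (A v))\<^sup>2 = (k * norm v)\<^sup>2" .
  then show ?thesis
    by (rule power2_eq_imp_eq) (use \<open>k \<ge> 0\<close> in auto)
qed


text \<open>
  \<open>F\<close> and \<open>G\<close> span a space on which \<open>A\<close> is bounded below by \<open>d\<close>. By the dimension count it meets
  the span of \<open>W\<close>, on which \<open>A\<close> stretches every vector by the same factor \<open>k\<close>.
\<close>

lemma stretch_factor_ge: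
  fixes A :: "'a::real_inner \<Rightarrow> 'a"
  assumes A: "linear A" and sym: "\<And>x y. inner (A x) y = inner x (A y)" and "d > 0"
    and F: "finite F" "orthonormal F" "pairwise (\<lambda>f g. inner (A f) g = 0) F"
      "\<And>f. f \<in> F \<Longrightarrow> inner (A f) f \<le> - d"
    and G: "finite G" "orthonormal G" "pairwise (\<lambda>f g. inner (A f) g = 0) G"
      "\<And>f. f \<in> G \<Longrightarrow> d \<le> inner (A f) f"
    and W: "finite W" "0 \<notin> W" "pairwise orthogonal W"
      "pairwise (\<lambda>u v. orthogonal (A u) (A v)) W"
    and k: "k \<ge> 0" "\<And>w. w \<in> W \<Longrightarrow> norm (A w) = k * norm w"
    and E: "finite E" "F \<union> G \<union> W \<subseteq> span E" "card E < card F + card G + card W"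
  shows "d \<le> k"
proof -
  have neg: "inner (A x) x \<le> - d * (norm x)\<^sup>2" if "x \<in> span F" for x
    by (rule quadratic_form_le_on_span[OF F(1,2) A F(3,4) that])
  have pos: "d * (norm x)\<^sup>2 \<le> inner (A x) x" if "x \<in> span G" for x
    by (rule quadratic_form_ge_on_span[OF G(1,2) A G(3,4) that])
  \<comment> \<open>A nonzero common vector would give the form both a negative and a positive
    value.\<close>
  have "x = 0" if "x \<in> span F" "x \<in> span G" for x
  proof (rule ccontr)
    assume "x \<noteq> 0"
    then have "0 < d * (norm x)\<^sup>2" using \<open>d > 0\<close> by simp
    then show False using neg[OF that(1)] pos[OF that(2)] by simp
  qed
  then have "span F \<inter> span G = {0}"
    using span_zero by blast
  note FG = independent_disjoint_union[OF F(1) G(1) orthonormal_independent[OF F(2)]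
      orthonormal_independent[OF G(2)] this]
  have "independent W"
    using W(2,3) pairwise_orthogonal_independent by blast
  have "\<exists>v. v \<in> span (F \<union> G) \<and> v \<in> span W \<and> v \<noteq> 0"
  proof (rule ccontr)
    assume "\<not> ?thesis"
    then have "span (F \<union> G) \<inter> span W = {0}"
      using span_zero by blast
    note FGW = independent_disjoint_union[OF _ W(1) FG(1) \<open>independent W\<close> this]
    have "card (F \<union> G \<union> W) = card F + card G + card W"
      using FGW(2) FG(2) F(1) G(1) W(1) by (simp add: card_Un_disjoint)
    moreover have "card (F \<union> G \<union> W) \<le> card E"
      using independent_span_bound[OF E(1) FGW(1) E(2)] F(1) G(1) by simp
    ultimately show False using E(3) by simp
  qed
  then obtain v where v: "v \<in> span (F \<union> G)" "v \<in> span W" "v \<noteq> 0" by blast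
  obtain x y where xy: "v = x + y" "x \<in> span F" "y \<in> span G"
    using v(1) by (auto simp: span_Un)
  have "d * norm v \<le> norm (A v)"
    unfolding xy(1) using \<open>d > 0\<close> by (intro norm_ge_of_definite_splitting A sym neg pos xy) simp
  also have "\<dots> = k * norm v"
    by (rule norm_image_orthogonal_span[OF W(1,3,4) A k(2,1) v(2)])
  finally show ?thesis using v(3) by simp
qed

section \<open>Surjectivity and approximate eigenvalues\<close>

text \<open>The composition of \<open>B\<close> after \<open>B'\<close> has the form
  \<open>(norm (B' x))\<^sup>2\<close>, so it is coercive. The equation \<open>B (B' x) = y\<close>
  is then solved by Banach's fixed point theorem.\<close>

lemma surj_if_adjoint_bounded_below:
  fixes B B' :: "'a::{real_inner,banach} \<Rightarrow> 'a"
  assumes B: "bounded_linear B" and B': "bounded_linear B'"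
    and adj: "\<And>x y. inner (B x) y = inner x (B' y)"
    and "\<delta> > 0" and below: "\<And>x. \<delta> * norm x \<le> norm (B' x)"
  shows "surj B"
proof (rule surjI)
  fix y
  define P where "P = (\<lambda>x. B (B' x))"
  have P: "bounded_linear P"
    unfolding P_def using bounded_linear_compose[OF B B'] by (simp add: o_def)
  obtain M where M: "M > 0" "\<And>x. norm (P x) \<le> norm x * M"
    using bounded_linear.pos_bounded[OF P] by blast
  \<comment> \<open>\<open>P\<close> is coercive, so \<open>x \<mapsto> x - \<tau> *\<^sub>R (P x - y)\<close> is a contraction for this step size.\<close>
  define \<tau> where "\<tau> = \<delta>\<^sup>2 / M\<^sup>2"
  \<comment> \<open>The squared contraction factor is bounded by \<open>1 - 2 * \<tau> *
    \<delta>\<^sup>2 + \<tau>\<^sup>2 * M\<^sup>2\<close>, which is smallest at the chosen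
    \<open>\<tau>\<close>. The maximum with 0 keeps its square root nonnegative.\<close>
  define q where "q = max 0 (1 - \<delta>\<^sup>2 * \<delta>\<^sup>2 / M\<^sup>2)"
  have contr: "norm (x - \<tau> *\<^sub>R P x) \<le> sqrt q * norm x" for x
  proof -
    have "(\<delta> * norm x)\<^sup>2 \<le> (norm (B' x))\<^sup>2"
      using \<open>\<delta> > 0\<close> by (intro power_mono below) simp
    moreover have "inner x (P x) = (norm (B' x))\<^sup>2"
      using adj[of "B' x" x] by (simp add: P_def power2_norm_eq_inner inner_commute)
    ultimately have 1: "\<delta>\<^sup>2 * (norm x)\<^sup>2 \<le> inner x (P x)"
      by (simp add: power_mult_distrib)
    have "(norm (P x))\<^sup>2 \<le> (norm x * M)\<^sup>2"
      by (intro power_mono M) simp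
    then have 2: "(norm (P x))\<^sup>2 \<le> (norm x)\<^sup>2 * M\<^sup>2"
      by (simp add: power_mult_distrib)
    have "(norm (x - \<tau> *\<^sub>R P x))\<^sup>2 = (norm x)\<^sup>2 - 2 * \<tau> * inner x (P x) + \<tau>\<^sup>2 * (norm (P x))\<^sup>2"
      unfolding power2_norm_eq_inner
      by (simp add: inner_simps inner_commute[of "P x" x] power2_eq_square algebra_simps)
    also have "\<dots> \<le> (norm x)\<^sup>2 - 2 * \<tau> * (\<delta>\<^sup>2 * (norm x)\<^sup>2) + \<tau>\<^sup>2 * ((norm x)\<^sup>2 * M\<^sup>2)"
      using 1 2 by (intro add_mono diff_mono mult_left_mono) (auto simp: \<tau>_def)
    also have "\<dots> = (1 - \<delta>\<^sup>2 * \<delta>\<^sup>2 / M\<^sup>2) * (norm x)\<^sup>2"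
      using M(1) by (simp add: \<tau>_def field_simps power2_eq_square)
    also have "\<dots> \<le> q * (norm x)\<^sup>2"
      unfolding q_def by (intro mult_right_mono) auto
    finally have "sqrt ((norm (x - \<tau> *\<^sub>R P x))\<^sup>2) \<le> sqrt (q * (norm x)\<^sup>2)"
      by (rule real_sqrt_le_mono)
    then show ?thesis by (simp add: real_sqrt_mult)
  qed
  define T where "T = (\<lambda>x. x - \<tau> *\<^sub>R P x + \<tau> *\<^sub>R y)"
  have "\<exists>!x. T x = x"
  proof (rule banach_fix_type[of "sqrt q"])
    show "0 \<le> sqrt q" by (simp add: q_def)
    have "\<delta>\<^sup>2 * \<delta>\<^sup>2 / M\<^sup>2 > 0" using \<open>\<delta> > 0\<close> M(1) by simp
    then show "sqrt q < 1" by (simp add: q_def)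
    have "T x - T x' = (x - x') - \<tau> *\<^sub>R P (x - x')" for x x'
      by (simp add: T_def linear_diff[OF bounded_linear.linear[OF P]] algebra_simps)
    then show "\<forall>x x'. dist (T x) (T x') \<le> sqrt q * dist x x'"
      using contr by (simp add: dist_norm)
  qed
  then obtain x where "T x = x" by blast
  then have "\<tau> *\<^sub>R P x = \<tau> *\<^sub>R y"
    by (auto simp: T_def algebra_simps)
  moreover have "\<tau> \<noteq> 0" using \<open>\<delta> > 0\<close> M(1) by (simp add: \<tau>_def)
  ultimately have "B (B' x) = y" by (simp add: P_def)
  then show "B (SOME x. B x = y) = y"
    by (rule someI)
qed


text \<open>Take \<open>l\<close> as the infimum of the form on unit vectors. Then \<open>D\<close>,
  which is \<open>A\<close> minus \<open>l\<close>, is nonnegative, and for such operators a small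
  value of the form forces a small \<open>norm (D u)\<close>; minimizing vectors are therefore
  approximate eigenvectors.\<close>

lemma approximate_eigenvalue_below:
  fixes A :: "'a::real_inner \<Rightarrow> 'a"
  assumes A: "bounded_linear A" and sym: "\<And>x y. inner (A x) y = inner x (A y)"
    and f: "norm f = 1"
  obtains l where "l \<le> inner (A f) f"
    "\<And>e. e > 0 \<Longrightarrow> \<exists>u. norm u = 1 \<and> norm (A u - l *\<^sub>R u) < e"
proof -
  define Q where "Q = (\<lambda>u. inner (A u) u) ` {u. norm u = 1}"
  define l where "l = Inf Q"
  obtain M where M: "M > 0" "\<And>x. norm (A x) \<le> norm x * M"
    using bounded_linear.pos_bounded[OF A] by blast
  have "- M \<le> inner (A u) u" if "norm u = 1" for u
    using Cauchy_Schwarz_ineq2[of "A u" u] M(2)[of u] that by simp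
  then have bdd: "bdd_below Q"
    by (auto simp: Q_def intro!: bdd_belowI)
  define D where "D = (\<lambda>x. A x - l *\<^sub>R x)"
  have D: "bounded_linear D"
    unfolding D_def
    by (intro bounded_linear_sub A bounded_linear_scaleR_right)
  note lin = bounded_linear.linear[OF D]
  obtain K where K: "K > 0" "\<And>x. norm (D x) \<le> norm x * K"
    using bounded_linear.pos_bounded[OF D] by blast
  have unit: "0 \<le> inner (D u) u" if "norm u = 1" for u
  proof -
    have "l \<le> inner (A u) u"
      unfolding l_def by (rule cInf_lower[OF _ bdd]) (use that in \<open>auto simp: Q_def\<close>)
    then show ?thesis
      using that by (simp add: D_def inner_diff_left flip: power2_norm_eq_inner)
  qed
  have nonneg: "0 \<le> inner (D x) x" for x
  proof (cases "x = 0")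
    case False
    have "0 \<le> inner (D ((1 / norm x) *\<^sub>R x)) ((1 / norm x) *\<^sub>R x)"
      using False by (intro unit) simp
    then have "0 \<le> inner (D x) x / (norm x)\<^sup>2"
      by (simp add: linear_cmul[OF lin] power2_eq_square)
    then show ?thesis
      using False pos_le_divide_eq[of "(norm x)\<^sup>2" 0 "inner (D x) x"] by simp
  qed (simp add: linear_0[OF lin])
  have bound: "(norm (D u))\<^sup>2 \<le> K * inner (D u) u" for u
  proof -
    let ?v = "D u"
    have sD: "inner (D x) y = inner x (D y)" for x y
      using sym by (simp add: D_def inner_simps)
    \<comment> \<open>Nonnegativity is tested at one gradient step from \<open>u\<close>, with step
      size \<open>1 / K\<close> matched to the bound on \<open>D\<close>.\<close>
    have "0 \<le> inner (D (u - (1 / K) *\<^sub>R ?v)) (u - (1 / K) *\<^sub>R ?v)"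
      by (rule nonneg)
    also have "\<dots> = inner (D u) u - 2 / K * (norm ?v)\<^sup>2 + 1 / K\<^sup>2 * inner (D ?v) ?v"
      unfolding power2_norm_eq_inner using sD[of ?v u] K(1)
      by (simp add: linear_diff[OF lin] linear_cmul[OF lin] inner_simps power2_eq_square
          field_simps)
    finally have 1: "0 \<le> inner (D u) u - 2 / K * (norm ?v)\<^sup>2 + 1 / K\<^sup>2 * inner (D ?v) ?v" .
    have "inner (D ?v) ?v \<le> K * (norm ?v)\<^sup>2"
      using Cauchy_Schwarz_ineq2[of "D ?v" ?v] mult_right_mono[OF K(2)[of ?v] norm_ge_zero[of ?v]]
      by (simp add: power2_eq_square mult_ac)
    then have "1 / K\<^sup>2 * inner (D ?v) ?v \<le> 1 / K\<^sup>2 * (K * (norm ?v)\<^sup>2)"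
      by (rule mult_left_mono) simp
    with 1 have "0 \<le> inner (D u) u - 2 / K * (norm ?v)\<^sup>2 + 1 / K\<^sup>2 * (K * (norm ?v)\<^sup>2)"
      by linarith
    also have "\<dots> = inner (D u) u - (norm ?v)\<^sup>2 / K"
      using K(1) by (simp add: power2_eq_square)
    finally have "(norm ?v)\<^sup>2 / K \<le> inner (D u) u"
      by simp
    then show ?thesis
      using K(1) by (simp add: divide_le_eq mult.commute)
  qed
  have "\<exists>u. norm u = 1 \<and> norm (A u - l *\<^sub>R u) < e" if e: "e > 0" for e
  proof -
    have "Q \<noteq> {}" using f by (auto simp: Q_def)
    moreover have "Inf Q < l + e\<^sup>2 / K" using e K(1) by (simp add: l_def)
    ultimately obtain q where "q \<in> Q" "q < l + e\<^sup>2 / K"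
      using cInf_lessD by blast
    then obtain u where u: "norm u = 1" "inner (A u) u < l + e\<^sup>2 / K"
      by (auto simp: Q_def)
    then have "inner (D u) u < e\<^sup>2 / K"
      by (simp add: D_def inner_diff_left flip: power2_norm_eq_inner)
    then have "K * inner (D u) u < e\<^sup>2"
      using K(1) by (simp add: less_divide_eq mult.commute)
    then have "(norm (D u))\<^sup>2 < e\<^sup>2"
      using bound[of u] by simp
    then have "norm (D u) < e"
      by (rule power2_less_imp_less) (use e in simp)
    then show ?thesis
      using u(1) by (auto simp: D_def)
  qed
  moreover have "l \<le> inner (A f) f"
    unfolding l_def by (rule cInf_lower[OF _ bdd]) (use f in \<open>auto simp: Q_def\<close>)
  ultimately show thesis using that by blast
qed

lemma approximate_eigenvalue_above:
  fixes A :: "'a::real_inner \<Rightarrow> 'a"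
  assumes A: "bounded_linear A" and sym: "\<And>x y. inner (A x) y = inner x (A y)"
    and f: "norm f = 1"
  obtains l where "inner (A f) f \<le> l"
    "\<And>e. e > 0 \<Longrightarrow> \<exists>u. norm u = 1 \<and> norm (A u - l *\<^sub>R u) < e"
proof -
  obtain l where l: "l \<le> inner (- A f) f"
    "\<And>e. e > 0 \<Longrightarrow> \<exists>u. norm u = 1 \<and> norm (- A u - l *\<^sub>R u) < e"
    using approximate_eigenvalue_below[of "\<lambda>x. - A x" f] bounded_linear_minus[OF A] sym f
    by auto
  have "norm (- A u - l *\<^sub>R u) = norm (A u - (- l) *\<^sub>R u)" for u
  proof -
    have "- A u - l *\<^sub>R u = - (A u - (- l) *\<^sub>R u)"
      by simp
    then show ?thesis by (simp only: norm_minus_cancel)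
  qed
  then show thesis
    using that[of "- l"] l(1) l(2) by simp
qed

section \<open>Complex scalars and criteria for the pseudospectrum\<close>

lemma inner_scaleC_adjoint:
  fixes x y :: "'a::complex_hilbert_space"
  shows "inner (z *\<^sub>C x) y = inner x (cnj z *\<^sub>C y)"
proof -
  have "cinner x (cnj z *\<^sub>C y) = z * cinner x y"
    unfolding cinner_commute[of x "cnj z *\<^sub>C y"] cinner_commute[of x y]
    by (simp add: cinner_scaleC_left)
  then show ?thesis
    by (simp add: inner_eq_Re_cinner cinner_scaleC_left)
qed

lemma norm_scaleC:
  fixes x :: "'a::complex_hilbert_space"
  shows "norm (z *\<^sub>C x) = cmod z * norm x"
proof -
  have "(norm (z *\<^sub>C x))\<^sup>2 = inner (z *\<^sub>C x) (z *\<^sub>C x)"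
    by (rule power2_norm_eq_inner)
  also have "\<dots> = inner x (of_real ((cmod z)\<^sup>2) *\<^sub>C x)"
    unfolding complex_norm_square
    by (simp add: inner_scaleC_adjoint scaleC_scaleC mult.commute[of "cnj z"])
  also have "\<dots> = (cmod z * norm x)\<^sup>2"
    by (simp add: scaleR_scaleC[symmetric] power2_norm_eq_inner power_mult_distrib)
  finally show ?thesis
    by (rule power2_eq_imp_eq) auto
qed

lemma bounded_linear_scaleC: "bounded_linear (\<lambda>x::'a::complex_hilbert_space. z *\<^sub>C x)"
  by (rule bounded_linear_intro[where K = "cmod z"])
     (simp_all add: scaleC_add_right scaleR_scaleC scaleC_scaleC norm_scaleC mult.commute)

lemma scaleC_diff_right: "z *\<^sub>C (x - y) = z *\<^sub>C x - z *\<^sub>C y"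
  for x y :: "'a::complex_hilbert_space"
  by (rule linear_diff[OF bounded_linear.linear[OF bounded_linear_scaleC]])

text \<open>\<open>J\<close> may be non-normal, so two lower bounds are required: the one for
  \<open>J\<close> gives injectivity and the resolvent estimate \<open>1 / \<delta>\<close>, the one
  for the adjoint \<open>J'\<close> gives surjectivity. Strictness of
  \<open>\<epsilon> < \<delta>\<close> excludes the boundary case of the pseudospectrum.\<close>

lemma notin_pseudospectrumI:
  fixes J J' :: "'a::complex_hilbert_space \<Rightarrow> 'a"
  assumes J: "bounded_clinear J" and J': "bounded_clinear J'"
    and adj: "\<And>x y. inner (J x) y = inner x (J' y)"
    and "0 \<le> \<epsilon>" "\<epsilon> < \<delta>"
    and below: "\<And>x. \<delta> * norm x \<le> norm (z *\<^sub>C x - J x)"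
    and below': "\<And>x. \<delta> * norm x \<le> norm (cnj z *\<^sub>C x - J' x)"
  shows "z \<notin> pseudospectrum \<epsilon> J"
proof -
  define B where "B = (\<lambda>x. z *\<^sub>C x - J x)"
  define R where "R = op_resolvent J z"
  have "\<delta> > 0" using assms(4,5) by simp
  have B: "bounded_linear B"
    unfolding B_def using J by (intro bounded_linear_sub bounded_linear_scaleC)
      (simp add: bounded_clinear_def)
  note lin = bounded_linear.linear[OF B]
  have "surj B"
  proof (rule surj_if_adjoint_bounded_below[OF B _ _ \<open>\<delta> > 0\<close> below'])
    show "bounded_linear (\<lambda>x. cnj z *\<^sub>C x - J' x)"
      using J' by (intro bounded_linear_sub bounded_linear_scaleC)
        (simp add: bounded_clinear_def)
    show "inner (B x) y = inner x (cnj z *\<^sub>C y - J' y)" for x y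
      by (simp add: B_def inner_diff_left inner_diff_right adj inner_scaleC_adjoint)
  qed
  moreover have "inj B"
    unfolding linear_inj_iff_eq_0[OF lin] using below \<open>\<delta> > 0\<close>
    by (metis B_def mult_le_0_iff norm_le_zero_iff norm_zero not_less)
  ultimately have "bij B" by (simp add: bij_def)
  have R: "R = inv B" by (simp add: R_def op_resolvent_def B_def)
  have BR: "B (R x) = x" for x
    unfolding R using \<open>surj B\<close> by (rule surj_f_inv_f)
  have RI: "R x = y" if "B y = x" for x y
    unfolding R using \<open>inj B\<close> that by (simp add: inv_f_eq)
  have norm_R: "norm (R x) \<le> norm x * (1 / \<delta>)" for x
    using below[of "R x"] \<open>\<delta> > 0\<close> BR[of x] by (simp add: B_def field_simps)
  have "bounded_linear R"
  proof (rule bounded_linear_intro[OF _ _ norm_R])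
    show "R (x + y) = R x + R y" for x y
      by (rule RI) (simp add: linear_add[OF lin] BR)
    show "R (r *\<^sub>R x) = r *\<^sub>R R x" for r x
      by (rule RI) (simp add: linear_cmul[OF lin] BR)
  qed
  moreover have "R (w *\<^sub>C x) = w *\<^sub>C R x" for w x
  proof (rule RI)
    have "B (w *\<^sub>C R x) = w *\<^sub>C B (R x)"
      using J by (simp add: B_def scaleC_diff_right scaleC_scaleC mult.commute bounded_clinear_def)
    then show "B (w *\<^sub>C R x) = w *\<^sub>C x" by (simp add: BR)
  qed
  ultimately have "z \<notin> op_spectrum J"
    using \<open>bij B\<close> by (simp add: op_spectrum_def bounded_clinear_def B_def R_def)
  moreover have "onorm R \<le> 1 / \<delta>"
    by (rule onorm_bound) (use \<open>\<delta> > 0\<close> norm_R in \<open>simp_all add: mult.commute\<close>)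
  then have "onorm R < 1 / \<epsilon>" if "\<epsilon> > 0"
    using that \<open>\<epsilon> < \<delta>\<close> frac_less2[of 1 1 \<epsilon> \<delta>] by simp
  ultimately show ?thesis
    by (auto simp: pseudospectrum_def R_def)
qed

text \<open>Outside the spectrum, applying the resolvent to the residual of a unit vector
  \<open>u\<close> recovers \<open>u\<close>. So the resolvent norm times \<open>w + e\<close> is at
  least 1, and \<open>e\<close> tends to 0.\<close>

lemma in_pseudospectrumI:
  fixes J :: "'a::complex_hilbert_space \<Rightarrow> 'a"
  assumes "w \<le> \<epsilon>"
    and approx: "\<And>e. e > 0 \<Longrightarrow> \<exists>u. norm u = 1 \<and> norm (z *\<^sub>C u - J u) \<le> w + e"
  shows "z \<in> pseudospectrum \<epsilon> J"
proof (cases "z \<in> op_spectrum J")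
  case False
  define R where "R = op_resolvent J z"
  have bij: "bij (\<lambda>x. z *\<^sub>C x - J x)" and R: "bounded_linear R"
    using False by (auto simp: op_spectrum_def bounded_clinear_def R_def)
  have RB: "R (z *\<^sub>C x - J x) = x" for x
    unfolding R_def op_resolvent_def
    using inv_f_f[OF bij_is_inj[OF bij], of x] by simp
  have "1 \<le> onorm R * (w + e)" if e: "e > 0" for e
  proof -
    obtain u where u: "norm u = 1" "norm (z *\<^sub>C u - J u) \<le> w + e"
      using approx[OF e] by blast
    have "1 \<le> onorm R * norm (z *\<^sub>C u - J u)"
      using onorm[OF R, of "z *\<^sub>C u - J u"] u(1) by (simp add: RB)
    also have "\<dots> \<le> onorm R * (w + e)"
      by (intro mult_left_mono u onorm_pos_le R)
    finally show ?thesis .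
  qed
  then have *: "1 \<le> onorm R * w + onorm R * e" if "e > 0" for e
    using that by (simp add: distrib_left)
  have Rw: "1 \<le> onorm R * w"
  proof (rule field_le_epsilon)
    fix e :: real assume e: "e > 0"
    have "onorm R * (e / (onorm R + 1)) \<le> e"
      using e onorm_pos_le[OF R] by (simp add: field_simps)
    then show "1 \<le> onorm R * w + e"
      using *[of "e / (onorm R + 1)"] e onorm_pos_le[OF R] by (simp add: add_nonneg_pos)
  qed
  \<comment> \<open>In particular \<open>w = 0\<close> is possible only inside the spectrum.
    Positivity of \<open>w\<close> also yields \<open>\<epsilon> > 0\<close>, the guard in
    \<open>pseudospectrum\<close>.\<close>
  then have "w > 0"
    using onorm_pos_le[OF R] mult_nonneg_nonpos[of "onorm R" w] by linarith
  have "1 / \<epsilon> \<le> 1 / w"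
    using \<open>w > 0\<close> assms(1) by (intro frac_le) auto
  also have "\<dots> \<le> onorm R"
    using Rw \<open>w > 0\<close> by (simp add: divide_le_eq)
  finally have "onorm R \<ge> 1 / \<epsilon>" .
  then show ?thesis
    using False \<open>w > 0\<close> assms(1) by (simp add: pseudospectrum_def R_def)
qed (simp add: pseudospectrum_def)

section \<open>Finitely supported vectors\<close>

lift_definition unit_ell2 :: "'i \<Rightarrow> 'i ell2" is "\<lambda>i j. if j = i then 1 else 0"
proof -
  fix i :: 'i
  have "(\<lambda>j. (cmod (if j = i then 1 else 0))\<^sup>2) summable_on {i}"
    by simp
  then show "(\<lambda>j. (cmod (if j = i then 1 else 0))\<^sup>2) summable_on UNIV"
    by (rule summable_on_cong_neutral[THEN iffD1, rotated 3]) auto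
qed

lift_definition shift_ell2 :: "int \<Rightarrow> int ell2 \<Rightarrow> int ell2" is "\<lambda>k u n. u (n - k)"
  subgoal for k u
    using summable_on_int_shift[of "\<lambda>n. (cmod (u n))\<^sup>2" "- k"] by simp
  done

text \<open>\<open>span\<close> consists of real combinations, so dimensions are counted over the
  reals. Restricting to real entries makes each site contribute one dimension instead of
  two.\<close>

definition real_supported :: "'i set \<Rightarrow> 'i ell2 \<Rightarrow> bool"
  where "real_supported T u \<longleftrightarrow> (\<forall>n. Im (ell2_nth u n) = 0 \<and> (n \<notin> T \<longrightarrow> ell2_nth u n = 0))"

lemmas ell2_nth_simps = unit_ell2.rep_eq shift_ell2.rep_eq plus_ell2.rep_eq zero_ell2.rep_eq
  scaleR_ell2.rep_eq scaleC_ell2.rep_eq ell2_nth_diff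

lemma ell2_nth_sum: "ell2_nth (\<Sum>x\<in>A. f x) n = (\<Sum>x\<in>A. ell2_nth (f x) n)"
  by (induction A rule: infinite_finite_induct) (simp_all add: ell2_nth_simps)

lemma inner_unit_ell2: "inner u (unit_ell2 i) = Re (ell2_nth u i)"
proof -
  have "(\<Sum>\<^sub>\<infinity>n. ell2_nth u n * cnj (ell2_nth (unit_ell2 i) n)) =
      (\<Sum>\<^sub>\<infinity>n\<in>{i}. ell2_nth u n * cnj (ell2_nth (unit_ell2 i) n))"
    by (rule infsum_cong_neutral) (auto simp: ell2_nth_simps)
  then show ?thesis
    by (simp add: inner_ell2_def ell2_nth_simps)
qed

lemma orthonormal_unit_ell2: "orthonormal (unit_ell2 ` T)"
proof -
  have "inner (unit_ell2 i) (unit_ell2 j) = (if i = j then 1 else 0)" for i j :: 'a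
    by (simp add: inner_unit_ell2 ell2_nth_simps)
  then show ?thesis
    by (auto simp: orthonormal_def pairwise_def orthogonal_def norm_eq_sqrt_inner)
qed

lemma inj_unit_ell2: "inj unit_ell2"
proof (rule injI)
  fix i j :: 'a
  assume "unit_ell2 i = unit_ell2 j"
  then have "ell2_nth (unit_ell2 i) i = ell2_nth (unit_ell2 j) i" by simp
  then show "i = j" by (simp add: ell2_nth_simps split: if_splits)
qed

lemma inner_eq_0_if_disjoint_support:
  assumes "\<And>n. ell2_nth u n = 0 \<or> ell2_nth v n = 0"
  shows "inner u v = 0"
proof -
  have "ell2_nth u n * cnj (ell2_nth v n) = 0" for n
    using assms[of n] by auto
  then show ?thesis unfolding inner_ell2_def by (subst infsum_0) simp_all
qed

lemma inner_shift_ell2: "inner (shift_ell2 k u) (shift_ell2 k v) = inner u v"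
proof -
  have "bij (\<lambda>n::int. n - k)"
    by (rule bij_betw_byWitness[where f' = "\<lambda>n. n + k"]) auto
  from infsum_reindex_bij_betw[OF this, of "\<lambda>n. ell2_nth u n * cnj (ell2_nth v n)"]
  show ?thesis
    by (simp add: inner_ell2_def ell2_nth_simps)
qed

lemma norm_shift_ell2: "norm (shift_ell2 k u) = norm u"
  by (simp add: norm_eq_sqrt_inner inner_shift_ell2)

lemma span_unit_ell2_iff:
  assumes "finite T"
  shows "u \<in> span (unit_ell2 ` T) \<longleftrightarrow> real_supported T u"
proof
  assume "u \<in> span (unit_ell2 ` T)"
  then show "real_supported T u"
  proof (induction rule: span_induct)
    case base
    show ?case
      by (rule subspaceI) (auto simp: real_supported_def ell2_nth_simps)
  qed (auto simp: real_supported_def ell2_nth_simps)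
next
  assume u: "real_supported T u"
  have "u = (\<Sum>n\<in>T. Re (ell2_nth u n) *\<^sub>R unit_ell2 n)"
  proof (rule ell2_eqI)
    fix i
    have "ell2_nth (\<Sum>n\<in>T. Re (ell2_nth u n) *\<^sub>R unit_ell2 n) i
        = (\<Sum>n\<in>T. if i = n then of_real (Re (ell2_nth u n)) else 0)"
      unfolding ell2_nth_sum by (intro sum.cong) (auto simp: ell2_nth_simps scaleR_conv_of_real)
    also have "\<dots> = ell2_nth u i"
      using u assms by (auto simp: real_supported_def complex_eq_iff)
    finally show "ell2_nth u i = ell2_nth (\<Sum>n\<in>T. Re (ell2_nth u n) *\<^sub>R unit_ell2 n) i" by simp
  qed
  also have "\<dots> \<in> span (unit_ell2 ` T)"
    by (intro span_sum span_scale span_base) simp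
  finally show "u \<in> span (unit_ell2 ` T)" .
qed

section \<open>Real and imaginary parts, and density of finite support\<close>

lemma inner_scaleC_ii_real:
  assumes "\<And>n. Im (ell2_nth u n) = 0" "\<And>n. Im (ell2_nth v n) = 0"
  shows "inner u (\<i> *\<^sub>C v) = 0"
proof -
  have "inner u (\<i> *\<^sub>C v) = (\<Sum>\<^sub>\<infinity>n. Re (ell2_nth u n * cnj (ell2_nth (\<i> *\<^sub>C v) n)))"
    unfolding inner_ell2_def by (rule infsum_Re[OF ell2_mult_summable, symmetric])
  also have "\<dots> = 0"
    using assms by (simp add: ell2_nth_simps)
  finally show ?thesis .
qed

text \<open>This reduces norm inequalities for operators with real entries to real vectors.\<close>

lemma norm_add_scaleC_ii_real:
  assumes "\<And>n. Im (ell2_nth u n) = 0" "\<And>n. Im (ell2_nth v n) = 0"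
  shows "(norm (u + \<i> *\<^sub>C v))\<^sup>2 = (norm u)\<^sup>2 + (norm v)\<^sup>2"
proof -
  have "(norm (u + \<i> *\<^sub>C v))\<^sup>2 = (norm u)\<^sup>2 + (norm (\<i> *\<^sub>C v))\<^sup>2"
    using inner_scaleC_ii_real[OF assms]
    by (simp add: power2_norm_eq_inner inner_add_left inner_add_right inner_commute[of "\<i> *\<^sub>C v" u])
  then show ?thesis by (simp add: norm_scaleC)
qed

lemma finite_support_dense:
  fixes u :: "'i ell2"
  assumes "e > 0"
  obtains v T where "finite T" "\<And>n. n \<notin> T \<Longrightarrow> ell2_nth v n = 0" "norm (u - v) < e"
proof -
  \<comment> \<open>The approximation of the sum comes with a weak inequality; halving makes it
    strict.\<close>
  have "e\<^sup>2 / 2 > 0" "e\<^sup>2 / 2 < e\<^sup>2" using assms by simp_all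
  with infsum_finite_approximation[OF ell2_nth_summable[of u], of "e\<^sup>2 / 2"]
  obtain T where T: "finite T"
    "dist (\<Sum>n\<in>T. (cmod (ell2_nth u n))\<^sup>2) (\<Sum>\<^sub>\<infinity>n. (cmod (ell2_nth u n))\<^sup>2) < e\<^sup>2"
    using le_less_trans by blast
  define f where "f n = (if n \<in> T then ell2_nth u n else 0)" for n
  have "(\<lambda>n. (cmod (f n))\<^sup>2) summable_on UNIV"
    by (rule summable_on_comparison_test[OF ell2_nth_summable[of u]]) (auto simp: f_def)
  then have f: "ell2_nth (Abs_ell2 f) = f"
    by (simp add: Abs_ell2_inverse)
  have sT: "(\<lambda>n. (cmod (ell2_nth u n))\<^sup>2) summable_on T" "(\<lambda>n. (cmod (ell2_nth u n))\<^sup>2) summable_on - T"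
    using T(1) summable_on_subset_banach[OF ell2_nth_summable[of u]] by auto
  have "(\<Sum>\<^sub>\<infinity>n. (cmod (ell2_nth (u - Abs_ell2 f) n))\<^sup>2) = (\<Sum>\<^sub>\<infinity>n\<in>-T. (cmod (ell2_nth u n))\<^sup>2)"
    by (rule infsum_cong_neutral) (auto simp: ell2_nth_diff f f_def)
  also have "\<dots> = (\<Sum>\<^sub>\<infinity>n. (cmod (ell2_nth u n))\<^sup>2) - (\<Sum>n\<in>T. (cmod (ell2_nth u n))\<^sup>2)"
    using infsum_Un_disjoint[OF sT] T(1) by (simp add: Compl_partition)
  also have "\<dots> < e\<^sup>2"
    using T(2) by (simp add: dist_real_def)
  finally have "norm (u - Abs_ell2 f) < sqrt (e\<^sup>2)"
    unfolding norm_ell2_def by (rule real_sqrt_less_mono)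
  then have "norm (u - Abs_ell2 f) < e" using assms by simp
  then show thesis
    by (intro that[of T "Abs_ell2 f"] T(1)) (auto simp: f f_def)
qed

section \<open>Periodic Jacobi operators\<close>

text \<open>Orthonormal vectors that diagonalize the compression of \<open>A\<close> to their span,
  without being eigenvectors of \<open>A\<close>. Indexing the family keeps track of which value of
  the form belongs to which vector after translation.\<close>

definition diagonal_family :: "('a::real_inner \<Rightarrow> 'a) \<Rightarrow> 'b set \<Rightarrow> ('b \<Rightarrow> 'a) \<Rightarrow> bool"
  where "diagonal_family A T f \<longleftrightarrow> (\<forall>t\<in>T. norm (f t) = 1) \<and>
    (\<forall>t\<in>T. \<forall>t'\<in>T. t \<noteq> t' \<longrightarrow> inner (f t) (f t') = 0 \<and> inner (A (f t)) (f t') = 0)"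

section \<open>Adjoint and symmetric part of a Jacobi operator\<close>

text \<open>The three diagonals are treated separately; moving the summation index by one turns the
  upper diagonal into the lower one.\<close>

lemma inner_jacobi:
  assumes ba: "bounded (range a)" and bb: "bounded (range b)" and bc: "bounded (range c)"
  shows "inner (jacobi a b c u) v = inner u (jacobi a c b v)"
proof -
  have b0: "bounded (range (\<lambda>_::int. 0::real))" by simp
  have split: "jacobi a b c u =
      jacobi (\<lambda>_. 0) (\<lambda>_. 0) c u + jacobi a (\<lambda>_. 0) (\<lambda>_. 0) u + jacobi (\<lambda>_. 0) b (\<lambda>_. 0) u"
    if "bounded (range b)" "bounded (range c)" for b c u
    by (rule ell2_eqI) (simp add: plus_ell2.rep_eq ell2_nth_jacobi ba that b0)
  have up: "inner (jacobi (\<lambda>_. 0) b (\<lambda>_. 0) u) v = inner u (jacobi (\<lambda>_. 0) (\<lambda>_. 0) b v)"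
    if "bounded (range b)" for b u v
  proof -
    have "bij (\<lambda>n::int. n + 1)"
      by (rule bij_betw_byWitness[where f' = "\<lambda>n. n - 1"]) auto
    from infsum_reindex_bij_betw[OF this,
        of "\<lambda>n. of_real (b (n - 1)) * ell2_nth u n * cnj (ell2_nth v (n - 1))"]
    show ?thesis
      by (simp add: inner_ell2_def ell2_nth_jacobi that mult_ac)
  qed
  have diag: "inner (jacobi a (\<lambda>_. 0) (\<lambda>_. 0) u) v = inner u (jacobi a (\<lambda>_. 0) (\<lambda>_. 0) v)"
    by (simp add: inner_ell2_def ell2_nth_jacobi ba mult_ac)
  have down: "inner (jacobi (\<lambda>_. 0) (\<lambda>_. 0) c u) v = inner u (jacobi (\<lambda>_. 0) c (\<lambda>_. 0) v)"
    using up[OF bc, of v u] by (simp add: inner_commute)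
  show ?thesis
    unfolding split[OF bb bc] split[OF bc bb] by (simp add: inner_simps up[OF bb] diag down)
qed

text \<open>The difference has off-diagonal entries \<open>(b - c) / 2\<close> above and
  \<open>(c - b) / 2\<close> below. Each of these is a weighted shift of norm at most
  \<open>w / 2\<close>.\<close>

lemma norm_jacobi_diff_le:
  assumes ba: "bounded (range a)" and bb: "bounded (range b)" and bc: "bounded (range c)"
    and w: "\<And>n. \<bar>b n - c n\<bar> \<le> w"
  shows "norm (jacobi a b c u - jacobi a (\<lambda>n. (b n + c n) / 2) (\<lambda>n. (b n + c n) / 2) u)
    \<le> w * norm u"
proof -
  have b0: "bounded (range (\<lambda>_::int. 0::real))" by simp
  let ?s = "\<lambda>n. (b n + c n) / 2" and ?d = "\<lambda>n. (b n - c n) / 2" and ?d' = "\<lambda>n. (c n - b n) / 2"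
  have bounded_scale: "bounded (range (\<lambda>n. f n / 2))" if "bounded (range f)" for f :: "int \<Rightarrow> real"
    using bounded_scaleR_comp[OF that, of "1 / 2"] by simp
  have bs: "bounded (range ?s)" and bd: "bounded (range ?d)" and bd': "bounded (range ?d')"
    by (intro bounded_scale bounded_plus_comp bounded_minus_comp bb bc)+
  have *: "jacobi a b c u - jacobi a ?s ?s u =
      jacobi (\<lambda>_. 0) ?d (\<lambda>_. 0) u + jacobi (\<lambda>_. 0) (\<lambda>_. 0) ?d' u"
    by (rule ell2_eqI)
       (simp add: ell2_nth_simps ell2_nth_jacobi ba bb bc bs bd bd' b0 field_simps)
  have dw: "cmod (complex_of_real (?d n)) \<le> w / 2" "cmod (complex_of_real (?d' n)) \<le> w / 2" for n
    unfolding norm_of_real using w[of n] by auto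
  have "norm (jacobi (\<lambda>_. 0) ?d (\<lambda>_. 0) u) \<le> w / 2 * norm u"
    by (rule norm_ell2_shift_bound[where k = 1 and f = "\<lambda>n. complex_of_real (?d n)"])
       (use dw in \<open>simp_all only: ell2_nth_jacobi[OF b0 bd b0], simp_all\<close>)
  moreover have "norm (jacobi (\<lambda>_. 0) (\<lambda>_. 0) ?d' u) \<le> w / 2 * norm u"
    by (rule norm_ell2_shift_bound[where k = "-1" and f = "\<lambda>n. complex_of_real (?d' (n - 1))"])
       (use dw in \<open>simp_all only: ell2_nth_jacobi[OF b0 b0 bd'], simp_all\<close>)
  ultimately show ?thesis
    unfolding * using norm_triangle_ineq[of "jacobi (\<lambda>_. 0) ?d (\<lambda>_. 0) u" "jacobi (\<lambda>_. 0) (\<lambda>_. 0) ?d' u"]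
    by simp
qed

section \<open>The symmetric periodic operator and its blocks\<close>

context
  fixes a s :: "int \<Rightarrow> real" and p :: nat and A :: "int ell2 \<Rightarrow> int ell2"
  assumes p: "p \<ge> 1" and pa: "periodic_seq p a" and ps: "periodic_seq p s"
  defines "A \<equiv> jacobi a s s"
begin

lemma bounded_coeffs: "bounded (range a)" "bounded (range s)"
  using bounded_periodic_seq p pa ps by auto

lemma ell2_nth_A: "ell2_nth (A u) n = of_real (s (n - 1)) * ell2_nth u (n - 1)
    + of_real (a n) * ell2_nth u n + of_real (s n) * ell2_nth u (n + 1)"
  unfolding A_def by (rule ell2_nth_jacobi[OF bounded_coeffs(1,2,2)])

lemma bounded_clinear_A: "bounded_clinear A"
  unfolding A_def by (rule bounded_clinear_jacobi[OF bounded_coeffs(1,2,2)])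

lemma bounded_linear_A: "bounded_linear A"
  using bounded_clinear_A by (simp add: bounded_clinear_def)

lemma A_scaleC: "A (z *\<^sub>C u) = z *\<^sub>C A u"
  using bounded_clinear_A by (simp add: bounded_clinear_def)

lemma inner_A: "inner (A u) v = inner u (A v)"
  unfolding A_def by (rule inner_jacobi[OF bounded_coeffs(1,2,2)])

lemma A_real: "(\<And>n. Im (ell2_nth u n) = 0) \<Longrightarrow> Im (ell2_nth (A u) n) = 0"
  by (simp add: ell2_nth_A)

lemma A_support:
  assumes "\<And>n. n \<notin> {l..h} \<Longrightarrow> ell2_nth u n = 0" "n \<notin> {l - 1..h + 1}"
  shows "ell2_nth (A u) n = 0"
  using assms(1)[of "n - 1"] assms(1)[of n] assms(1)[of "n + 1"] assms(2)
  by (auto simp: ell2_nth_A)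

lemma A_shift: "A (shift_ell2 (int p * k) u) = shift_ell2 (int p * k) (A u)"
proof (rule ell2_eqI)
  fix n
  have "f (n - int p * k) = f n" if "periodic_seq p f" for f :: "int \<Rightarrow> real" and n
    using periodic_seq_mod[OF that, of "n - int p * k"] periodic_seq_mod[OF that, of n]
    by (simp add: mod_diff_eq[symmetric])
  note this[OF pa, of n] this[OF ps, of n] this[OF ps, of "n - 1"]
  then show "ell2_nth (A (shift_ell2 (int p * k) u)) n = ell2_nth (shift_ell2 (int p * k) (A u)) n"
    by (simp add: ell2_nth_A ell2_nth_simps algebra_simps)
qed

text \<open>The open interval omits the sites congruent to \<open>i\<close>. \<open>A\<close> moves
  support by at most one site, so a block leaks only into these separating sites and never into
  another block. The form therefore stays diagonal on the union of all translates.\<close>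

lemma block_family:
  fixes f :: "nat \<Rightarrow> int ell2" and N :: nat
  assumes "finite T" and supp: "\<forall>t\<in>T. real_supported {i<..<i + int p} (f t)"
    and diag: "diagonal_family A T f"
  defines "F \<equiv> (\<lambda>(l, t). shift_ell2 (int p * int l) (f t)) ` ({..<N} \<times> T)"
  shows "finite F" "orthonormal F" "pairwise (\<lambda>f g. inner (A f) g = 0) F" "card F = N * card T"
    "\<And>g. g \<in> F \<Longrightarrow> real_supported {i<..<i + int p * int N} g"
    "\<And>g. g \<in> F \<Longrightarrow> \<exists>t\<in>T. inner (A g) g = inner (A (f t)) (f t)"
proof -
  have f: "real_supported {i<..<i + int p} (f t)" "norm (f t) = 1" if "t \<in> T" for t
    using supp diag that by (auto simp: diagonal_family_def)
  have f': "inner (f t) (f t') = 0" "inner (A (f t)) (f t') = 0"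
    if "t \<in> T" "t' \<in> T" "t \<noteq> t'" for t t'
    using diag that by (auto simp: diagonal_family_def)
  define h where "h l t = shift_ell2 (int p * int l) (f t)" for l t
  have h_supp: "ell2_nth (h l t) n = 0"
    if "t \<in> T" "n \<notin> {i + int p * int l + 1..i + int p * int l + int p - 1}" for l t n
    using f(1)[OF that(1)] that(2) by (auto simp: h_def ell2_nth_simps real_supported_def)
  have Ah_supp: "ell2_nth (A (h l t)) n = 0"
    if "t \<in> T" "n \<notin> {i + int p * int l..i + int p * int l + int p}" for l t n
    by (rule A_support[where l = "i + int p * int l + 1" and h = "i + int p * int l + int p - 1",
          OF h_supp[OF that(1)]]) (use that(2) in auto)
  \<comment> \<open>The closed interval of block \<open>l'\<close>, separators included, misses the
    interior of every other block.\<close>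
  have far: "n \<notin> {i + int p * int l + 1..i + int p * int l + int p - 1}"
    if "l \<noteq> l'" "n \<in> {i + int p * int l'..i + int p * int l' + int p}" for l l' n
  proof (cases "l < l'")
    case True
    then have "int p * (int l + 1) \<le> int p * int l'" by (intro mult_left_mono) auto
    then show ?thesis using that(2) by (auto simp: algebra_simps)
  next
    case False
    then have "int p * (int l' + 1) \<le> int p * int l" using that(1) by (intro mult_left_mono) auto
    then show ?thesis using that(2) by (auto simp: algebra_simps)
  qed
  have unit: "norm (h l t) = 1" if "t \<in> T" for l t
    using f(2)[OF that] by (simp add: h_def norm_shift_ell2)
  have Aorth: "inner (A (h l t)) (h l' t') = 0" if "t \<in> T" "t' \<in> T" "(l, t) \<noteq> (l', t')" for l l' t t'
  proof (cases "l = l'")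
    case True
    then show ?thesis using f'(2)[OF that(1,2)] that(3)
      by (simp add: h_def A_shift inner_shift_ell2)
  next
    case False
    show ?thesis
    proof (rule inner_eq_0_if_disjoint_support)
      show "ell2_nth (A (h l t)) n = 0 \<or> ell2_nth (h l' t') n = 0" for n
        using Ah_supp[OF that(1)] h_supp[OF that(2) far[of l' l n]] False by metis
    qed
  qed
  have orth: "inner (h l t) (h l' t') = 0" if "t \<in> T" "t' \<in> T" "(l, t) \<noteq> (l', t')" for l l' t t'
  proof (cases "l = l'")
    case True
    then show ?thesis using f'(1)[OF that(1,2)] that(3)
      by (simp add: h_def inner_shift_ell2)
  next
    case False
    show ?thesis
    proof (rule inner_eq_0_if_disjoint_support)
      have "n \<in> {i + int p * int l..i + int p * int l + int p}"
        if "n \<in> {i + int p * int l + 1..i + int p * int l + int p - 1}" for n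
        using that by auto
      then show "ell2_nth (h l t) n = 0 \<or> ell2_nth (h l' t') n = 0" for n
        using h_supp[OF that(1)] h_supp[OF that(2) far[of l' l n]] False by metis
    qed
  qed
  have F: "F = (\<lambda>(l, t). h l t) ` ({..<N} \<times> T)"
    by (simp add: F_def h_def)
  have "inj_on (\<lambda>(l, t). h l t) ({..<N} \<times> T)"
  proof (rule inj_onI, clarify)
    fix l t l' t' assume t: "t \<in> T" "t' \<in> T" and eq: "h l t = h l' t'"
    show "l = l' \<and> t = t'"
    proof (rule ccontr)
      assume "\<not> (l = l' \<and> t = t')"
      then have "inner (h l t) (h l t) = 0"
        using orth[OF t, of l l'] eq by auto
      then show False using unit[OF t(1), of l] by simp
    qed
  qed
  then show "card F = N * card T"
    by (simp add: F card_image card_cartesian_product)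
  show "finite F" using \<open>finite T\<close> by (simp add: F)
  have pairs: "inner x y = 0 \<and> inner (A x) y = 0" if "x \<in> F" "y \<in> F" "x \<noteq> y" for x y
  proof -
    obtain l t l' t' where "t \<in> T" "t' \<in> T" "x = h l t" "y = h l' t'"
      using \<open>x \<in> F\<close> \<open>y \<in> F\<close> by (auto simp: F)
    moreover have "(l, t) \<noteq> (l', t')"
      using calculation \<open>x \<noteq> y\<close> by blast
    ultimately show ?thesis
      using orth Aorth by simp
  qed
  have "norm x = 1" if "x \<in> F" for x
    using that unit by (auto simp: F)
  then show "orthonormal F"
    unfolding orthonormal_def pairwise_def orthogonal_def using pairs by blast
  show "pairwise (\<lambda>f g. inner (A f) g = 0) F"
    unfolding pairwise_def using pairs by blast
  fix g assume "g \<in> F"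
  then obtain l t where g: "l < N" "t \<in> T" "g = h l t" by (auto simp: F)
  show "\<exists>t\<in>T. inner (A g) g = inner (A (f t)) (f t)"
    using g by (auto simp: h_def A_shift inner_shift_ell2)
  have "int p * (int l + 1) \<le> int p * int N" using g(1) by (intro mult_left_mono) auto
  then have le: "int p * int l + int p \<le> int p * int N" by (simp add: distrib_left)
  have ge: "0 \<le> int p * int l" by simp
  have "ell2_nth g n = 0" if "n \<notin> {i<..<i + int p * int N}" for n
    unfolding g(3)
  proof (rule h_supp[OF g(2)])
    show "n \<notin> {i + int p * int l + 1..i + int p * int l + int p - 1}"
      using that le ge unfolding greaterThanLessThan_iff atLeastAtMost_iff by linarith
  qed
  moreover have "Im (ell2_nth g n) = 0" for n
    using f(1)[OF g(2)] by (simp add: g(3) real_supported_def h_def ell2_nth_simps)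
  ultimately show "real_supported {i<..<i + int p * int N} g"
    by (auto simp: real_supported_def)
qed

text \<open>
  In a box of \<open>N + 1\<close> periods, the shifts of \<open>f\<close> and \<open>g\<close> provide \<open>N * p\<close> independent vectors,
  which is \<open>p\<close> short of the dimension of the box. This deficit is compensated by \<open>p + 1\<close> far apart
  translates of \<open>u\<close>.
\<close>

lemma definite_blocks_bound:
  fixes f g :: "nat \<Rightarrow> int ell2"
  assumes "d > 0" and T: "finite T" and U: "finite U" and card: "card T + card U = p"
    and i: "0 \<le> i" "i < int p" and j: "0 \<le> j" "j < int p"
    and f: "\<forall>t\<in>T. real_supported {i<..<i + int p} (f t)" "diagonal_family A T f"
      "\<And>t. t \<in> T \<Longrightarrow> inner (A (f t)) (f t) \<le> - d"
    and g: "\<forall>t\<in>U. real_supported {j<..<j + int p} (g t)" "diagonal_family A U g"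
      "\<And>t. t \<in> U \<Longrightarrow> d \<le> inner (A (g t)) (g t)"
    and u: "real_supported V u" "finite V"
  shows "d * norm u \<le> norm (A u)"
proof (cases "u = 0")
  case True
  then show ?thesis by simp
next
  case False
  \<comment> \<open>The set \<open>V\<close> lies between \<open>- M\<close> and \<open>M\<close>;
    inserting 0 keeps the maximum defined for empty \<open>V\<close>.\<close>
  define M where "M = nat (Max ((\<lambda>n. \<bar>n\<bar>) ` insert 0 V))"
  \<comment> \<open>A translate occupies at most \<open>2 * p * M + 1\<close> sites, and applying
    \<open>A\<close> adds one at each end. Spacing by \<open>p * R\<close> sites keeps the enlarged
    supports disjoint because \<open>3 * p > 2\<close>.\<close>
  define R where "R = 2 * M + 3"
  \<comment> \<open>Large enough for the box to hold the translates \<open>w 0\<close> to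
    \<open>w p\<close>.\<close>
  define N where "N = (p + 1) * R"
  define w where "w q = shift_ell2 (int p * (int M + int q * int R)) u" for q
  define k where "k = norm (A u) / norm u"
  have V: "\<bar>n\<bar> \<le> int M" if "n \<in> V" for n
    using Max_ge[of "(\<lambda>n. \<bar>n\<bar>) ` insert 0 V" "\<bar>n\<bar>"] u(2) that by (auto simp: M_def)
  have w_supp: "ell2_nth (w q) n = 0"
    if "n \<notin> {int p * int q * int R..int p * int q * int R + 2 * int p * int M}" for q n
  proof -
    have "int M \<le> int p * int M" using p mult_right_mono[of 1 "int p" "int M"] by simp
    then have "n - int p * (int M + int q * int R) \<notin> V"
      using that V[of "n - int p * (int M + int q * int R)"] by (auto simp: algebra_simps)
    then show ?thesis
      using u(1) by (simp add: w_def ell2_nth_simps real_supported_def)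
  qed
  have Aw_supp: "ell2_nth (A (w q)) n = 0"
    if "n \<notin> {int p * int q * int R - 1..int p * int q * int R + 2 * int p * int M + 1}" for q n
    by (rule A_support[where l = "int p * int q * int R"
          and h = "int p * int q * int R + 2 * int p * int M", OF w_supp]) (use that in auto)
  have sep: "int p * int q * int R + 2 * int p * int M + 1 < int p * int q' * int R - 1"
    if "q < q'" for q q'
  proof -
    have "int p * int R * (int q + 1) \<le> int p * int R * int q'"
      using that by (intro mult_left_mono) auto
    then show ?thesis using p by (simp add: R_def algebra_simps)
  qed
  have orth: "inner (w q) (w q') = 0" "inner (A (w q)) (A (w q')) = 0" if "q < q'" for q q'
  proof -
    have "ell2_nth (w q) n = 0 \<and> ell2_nth (A (w q)) n = 0 \<or>
        ell2_nth (w q') n = 0 \<and> ell2_nth (A (w q')) n = 0" for n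
    proof (cases "n \<le> int p * int q * int R + 2 * int p * int M + 1")
      case True
      then have "n < int p * int q' * int R - 1" using sep[OF that] by linarith
      then show ?thesis using w_supp[of n q'] Aw_supp[of n q'] by simp
    next
      case False
      then show ?thesis using w_supp[of n q] Aw_supp[of n q] by simp
    qed
    then show "inner (w q) (w q') = 0" "inner (A (w q)) (A (w q')) = 0"
      by (intro inner_eq_0_if_disjoint_support, blast)+
  qed
  have orth': "inner (w q) (w q') = 0 \<and> inner (A (w q)) (A (w q')) = 0" if "q \<noteq> q'" for q q'
  proof (cases "q < q'")
    case True
    then show ?thesis using orth by blast
  next
    case False
    then have "q' < q" using that by simp
    then show ?thesis
      using orth[of q' q] inner_commute[of "w q" "w q'"] inner_commute[of "A (w q)" "A (w q')"]
      by simp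
  qed
  have norm_w: "norm (w q) = norm u" "norm (A (w q)) = norm (A u)" for q
    by (simp_all add: w_def A_shift norm_shift_ell2)
  define W where "W = w ` {..p}"
  have "inj w"
  proof (rule injI, rule ccontr)
    fix q q' assume "w q = w q'" "q \<noteq> q'"
    then have "inner (w q) (w q) = 0" using orth'[of q q'] by simp
    then show False using norm_w(1)[of q] \<open>u \<noteq> 0\<close> by simp
  qed
  then have "card W = p + 1"
    unfolding W_def by (subst card_image) (auto intro: inj_on_subset)
  define F where "F = (\<lambda>(l, t). shift_ell2 (int p * int l) (f t)) ` ({..<N} \<times> T)"
  define G where "G = (\<lambda>(l, t). shift_ell2 (int p * int l) (g t)) ` ({..<N} \<times> U)"
  note F = block_family[where f = f and N = N, OF T f(1,2), folded F_def]
  note G = block_family[where f = g and N = N, OF U g(1,2), folded G_def]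
  define E where "E = unit_ell2 ` {0..<int p * int (N + 1)}"
  have E: "v \<in> span E \<longleftrightarrow> real_supported {0..<int p * int (N + 1)} v" for v
    unfolding E_def by (rule span_unit_ell2_iff) simp
  \<comment> \<open>The extra period of the box absorbs the offset of the blocks, which is smaller
    than \<open>p\<close>.\<close>
  have subset: "real_supported {0..<int p * int (N + 1)} v"
    if "real_supported {i<..<i + int p * int N} v" "0 \<le> i" "i < int p" for i v
    using that by (auto simp: real_supported_def algebra_simps)
  have "d \<le> k"
  proof (rule stretch_factor_ge[OF bounded_linear.linear[OF bounded_linear_A] inner_A \<open>d > 0\<close>
        F(1-3) _ G(1-3)])
    show "inner (A v) v \<le> - d" if "v \<in> F" for v
      using F(6)[OF that] f(3) by auto
    show "d \<le> inner (A v) v" if "v \<in> G" for v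
      using G(6)[OF that] g(3) by auto
    show "finite W" by (simp add: W_def)
    show "0 \<notin> W"
    proof
      assume "0 \<in> W"
      then obtain q where "w q = 0" by (auto simp: W_def)
      then show False using norm_w(1)[of q] \<open>u \<noteq> 0\<close> by simp
    qed
    have "inner v v' = 0 \<and> inner (A v) (A v') = 0" if "v \<in> W" "v' \<in> W" "v \<noteq> v'" for v v'
    proof -
      obtain q q' where "v = w q" "v' = w q'"
        using \<open>v \<in> W\<close> \<open>v' \<in> W\<close> by (auto simp: W_def)
      then show ?thesis using orth'[of q q'] that(3) by auto
    qed
    then show "pairwise orthogonal W" "pairwise (\<lambda>u v. orthogonal (A u) (A v)) W"
      by (auto simp: pairwise_def orthogonal_def)
    show "k \<ge> 0" by (simp add: k_def)
    show "norm (A v) = k * norm v" if "v \<in> W" for v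
      using that norm_w \<open>u \<noteq> 0\<close> by (auto simp: W_def k_def)
    show "finite E" by (simp add: E_def)
    have "card E = card {0..<int p * int (N + 1)}"
      unfolding E_def by (rule card_image[OF inj_on_subset[OF inj_unit_ell2 subset_UNIV]])
    also have "int p * int (N + 1) = int (p * (N + 1))"
      by (rule of_nat_mult[symmetric])
    also have "card {0..<int (p * (N + 1))} = p * (N + 1)"
      by (simp only: card_atLeastLessThan_int diff_zero nat_int)
    finally have "card E = p * (N + 1)" .
    moreover have "card F + card G = N * p"
      by (simp only: F(4) G(4) card flip: distrib_left)
    \<comment> \<open>The right side is \<open>N * p + p + 1\<close>, exactly one more than the
      dimension \<open>p * (N + 1)\<close> of the box.\<close>
    ultimately show "card E < card F + card G + card W"
      using \<open>card W = p + 1\<close> by (simp add: algebra_simps)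
    have "v \<in> span E" if "v \<in> F" for v
      unfolding E by (rule subset[OF F(5)[OF that] i])
    moreover have "v \<in> span E" if "v \<in> G" for v
      unfolding E by (rule subset[OF G(5)[OF that] j])
    moreover have "real_supported {0..<int p * int (N + 1)} (w q)" if "q \<le> p" for q
    proof -
      have "int p * int R * (int q + 1) \<le> int p * int R * (int p + 1)"
        using that by (intro mult_left_mono) auto
      then have hi: "int p * int q * int R + 2 * int p * int M < int p * int (N + 1)"
        using p by (simp add: R_def N_def algebra_simps)
      have lo: "0 \<le> int p * int q * int R" by simp
      have "ell2_nth (w q) n = 0" if "n \<notin> {0..<int p * int (N + 1)}" for n
      proof (rule w_supp)
        show "n \<notin> {int p * int q * int R..int p * int q * int R + 2 * int p * int M}"
          using that hi lo unfolding atLeastLessThan_iff atLeastAtMost_iff by linarith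
      qed
      moreover have "Im (ell2_nth (w q) n) = 0" for n
        using u(1) by (simp add: real_supported_def w_def ell2_nth_simps)
      ultimately show ?thesis
        unfolding real_supported_def by blast
    qed
    then have "v \<in> span E" if "v \<in> W" for v
      using that unfolding E W_def by auto
    ultimately show "F \<union> G \<union> W \<subseteq> span E" by blast
  qed
  then show ?thesis
    using \<open>u \<noteq> 0\<close> by (simp add: k_def le_divide_eq)
qed

text \<open>\<open>A\<close> has real entries, so it respects the splitting into real and imaginary
  parts, whose squared norms add up. This gives the bound for finite support; density and continuity
  do the rest.\<close>

lemma bound_from_real_finite_support:
  assumes "d \<ge> 0"
    and real: "\<And>V u. finite V \<Longrightarrow> real_supported V u \<Longrightarrow> d * norm u \<le> norm (A u)"
  shows "d * norm u \<le> norm (A u)"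
proof -
  have fin: "d * norm v \<le> norm (A v)" if V: "finite V" "\<And>n. n \<notin> V \<Longrightarrow> ell2_nth v n = 0" for v V
  proof -
    define x where "x = (\<Sum>n\<in>V. Re (ell2_nth v n) *\<^sub>R unit_ell2 n)"
    define y where "y = (\<Sum>n\<in>V. Im (ell2_nth v n) *\<^sub>R unit_ell2 n)"
    have "x \<in> span (unit_ell2 ` V)" "y \<in> span (unit_ell2 ` V)"
      unfolding x_def y_def by (rule span_sum, rule span_scale, rule span_base, simp)+
    then have xy: "real_supported V x" "real_supported V y"
      using span_unit_ell2_iff[OF V(1)] by blast+
    have nth: "ell2_nth (\<Sum>n\<in>V. r n *\<^sub>R unit_ell2 n) i = (if i \<in> V then of_real (r i) else 0)"
      for r i
    proof -
      have "ell2_nth (\<Sum>n\<in>V. r n *\<^sub>R unit_ell2 n) i = (\<Sum>n\<in>V. if i = n then of_real (r n) else 0)"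
        unfolding ell2_nth_sum by (intro sum.cong) (auto simp: ell2_nth_simps scaleR_conv_of_real)
      then show ?thesis using V(1) by simp
    qed
    have v_eq: "v = x + \<i> *\<^sub>C y"
      using V(2) by (intro ell2_eqI) (auto simp: x_def y_def ell2_nth_simps nth complex_eq_iff)
    have Av: "A v = A x + \<i> *\<^sub>C A y"
      unfolding v_eq by (simp add: linear_add[OF bounded_linear.linear[OF bounded_linear_A]] A_scaleC)
    have re: "Im (ell2_nth x n) = 0" "Im (ell2_nth y n) = 0" for n
      using xy by (simp_all add: real_supported_def)
    have "(d * norm v)\<^sup>2 = (d * norm x)\<^sup>2 + (d * norm y)\<^sup>2"
      unfolding power_mult_distrib v_eq norm_add_scaleC_ii_real[OF re] by (simp add: distrib_left)
    also have "\<dots> \<le> (norm (A x))\<^sup>2 + (norm (A y))\<^sup>2"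
      using \<open>d \<ge> 0\<close> by (intro add_mono power_mono real[OF V(1)] xy) auto
    also have "\<dots> = (norm (A v))\<^sup>2"
      unfolding Av by (rule norm_add_scaleC_ii_real[symmetric]) (intro A_real re)+
    finally show ?thesis
      by (rule power2_le_imp_le) simp
  qed
  define C where "C = {v. d * norm v \<le> norm (A v)}"
  have "continuous_on UNIV (\<lambda>v. norm (A v))"
    by (intro continuous_on_norm linear_continuous_on bounded_linear_A)
  then have "closed C"
    unfolding C_def by (rule closed_Collect_le[OF continuous_on_mult_left[OF continuous_on_norm_id]])
  moreover have "u \<in> closure C"
    unfolding closure_approachable
  proof (intro allI impI)
    fix e :: real assume "e > 0"
    obtain v V where v: "finite V" "\<And>n. n \<notin> V \<Longrightarrow> ell2_nth v n = 0" "norm (u - v) < e"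
      by (rule finite_support_dense[OF \<open>e > 0\<close>, of u]) (rule that)
    have "v \<in> C" unfolding C_def by (rule CollectI, rule fin[OF v(1,2)])
    moreover have "dist v u < e" using v(3) by (simp add: dist_norm norm_minus_commute)
    ultimately show "\<exists>v\<in>C. dist v u < e" by blast
  qed
  ultimately show ?thesis
    by (simp add: C_def)
qed

text \<open>By symmetry, \<open>A u\<close> is orthogonal to \<open>\<i> *\<^sub>C u\<close> in the
  real inner product. A lower bound for \<open>A\<close> thus persists under imaginary shifts, that
  is, along a whole vertical line.\<close>

lemma norm_A_minus_ii:
  "(norm (A u - complex_of_real t *\<^sub>C \<i> *\<^sub>C u))\<^sup>2 = (norm (A u))\<^sup>2 + t\<^sup>2 * (norm u)\<^sup>2"
proof -
  let ?v = "\<i> *\<^sub>C u"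
  have "inner (A u) ?v = inner u (A ?v)"
    by (rule inner_A)
  also have "\<dots> = inner (A ?v) u"
    by (rule inner_commute)
  also have "\<dots> = inner (A u) (cnj \<i> *\<^sub>C u)"
    unfolding A_scaleC by (rule inner_scaleC_adjoint)
  also have "cnj \<i> *\<^sub>C u = - ?v"
    by (rule ell2_eqI) (simp add: ell2_nth_simps uminus_ell2.rep_eq)
  finally have *: "inner (A u) ?v = 0" by simp
  then have **: "inner ?v (A u) = 0" by (subst inner_commute)
  have "(norm (A u - t *\<^sub>R ?v))\<^sup>2 = (norm (A u))\<^sup>2 + t\<^sup>2 * (norm ?v)\<^sup>2"
    unfolding power2_norm_eq_inner
    by (simp add: inner_diff_left inner_diff_right * ** power2_eq_square)
  then show ?thesis unfolding scaleR_scaleC by (simp add: norm_scaleC)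
qed

end

section \<open>Dirichlet eigenvalues\<close>

lemma periodic_seq_map2:
  "periodic_seq p f \<Longrightarrow> periodic_seq p g \<Longrightarrow> periodic_seq p (\<lambda>n. h (f n) (g n))"
  by (simp add: periodic_seq_def)

lemma jacobi_diff_scaleR:
  assumes "bounded (range a)" "bounded (range s)"
  shows "jacobi (\<lambda>n. a n - m) s s u = jacobi a s s u - m *\<^sub>R u"
proof -
  have "bounded (range (\<lambda>n. a n - m))"
    using assms(1) by (intro bounded_minus_comp) simp_all
  then show ?thesis
    using assms
    by (intro ell2_eqI) (simp add: ell2_nth_simps ell2_nth_jacobi scaleR_conv_of_real algebra_simps)
qed

text \<open>The imaginary part of \<open>z\<close> does not spoil the lower bound \<open>d\<close>
  for the symmetric part, and the antisymmetric remainder costs at most \<open>w\<close>.\<close>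

lemma norm_jacobi_resolvent_ge:
  assumes p: "p \<ge> 1" and per: "periodic_seq p a" "periodic_seq p b" "periodic_seq p c"
    and w: "\<And>n. \<bar>b n - c n\<bar> \<le> w"
    and below: "\<And>u. d * norm u
      \<le> norm (jacobi (\<lambda>n. a n - Re z) (\<lambda>n. (b n + c n) / 2) (\<lambda>n. (b n + c n) / 2) u)"
  shows "(d - w) * norm u \<le> norm (z *\<^sub>C u - jacobi a b c u)"
proof -
  define s where "s = (\<lambda>n. (b n + c n) / 2)"
  define A where "A = jacobi (\<lambda>n. a n - Re z) s s"
  have ps: "periodic_seq p s"
    unfolding s_def by (rule periodic_seq_map2[OF per(2,3)])
  have pa: "periodic_seq p (\<lambda>n. a n - Re z)"
    by (rule periodic_seq_map2[OF per(1) per(1)])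
  note bounded = bounded_periodic_seq[OF p]
  have A: "A u = jacobi a s s u - Re z *\<^sub>R u"
    unfolding A_def by (intro jacobi_diff_scaleR bounded per ps)
  let ?v = "A u - complex_of_real (Im z) *\<^sub>C \<i> *\<^sub>C u"
  let ?r = "jacobi a b c u - jacobi a s s u"
  have "z *\<^sub>C u = Re z *\<^sub>R u + complex_of_real (Im z) *\<^sub>C \<i> *\<^sub>C u"
  proof (rule ell2_eqI)
    fix n
    have "z * ell2_nth u n = (of_real (Re z) + of_real (Im z) * \<i>) * ell2_nth u n"
      using complex_eq[of z] by (simp add: mult.commute)
    then show "ell2_nth (z *\<^sub>C u) n
        = ell2_nth (Re z *\<^sub>R u + complex_of_real (Im z) *\<^sub>C \<i> *\<^sub>C u) n"
      by (simp add: ell2_nth_simps scaleR_conv_of_real distrib_right mult.assoc)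
  qed
  then have split: "z *\<^sub>C u - jacobi a b c u = - (?v + ?r)"
    by (simp add: A)
  have "(norm (A u))\<^sup>2 \<le> (norm ?v)\<^sup>2"
    unfolding A_def norm_A_minus_ii[OF p pa ps] by simp
  then have "norm (A u) \<le> norm ?v"
    by (rule power2_le_imp_le) simp
  moreover have "d * norm u \<le> norm (A u)"
    using below by (simp add: A_def s_def)
  moreover have "norm ?r \<le> w * norm u"
    unfolding s_def by (intro norm_jacobi_diff_le bounded per w)
  moreover have "norm ?v - norm ?r \<le> norm (?v + ?r)"
    by (rule norm_diff_ineq)
  ultimately have "d * norm u - w * norm u \<le> norm (?v + ?r)"
    by linarith
  then show ?thesis
    unfolding split norm_minus_cancel left_diff_distrib .
qed

text \<open>An approximate eigenvector of the symmetric part has a residual of at most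
  \<open>w + e\<close> for the full operator. The case \<open>w = \<epsilon>\<close> is covered
  because the resolvent bound in \<open>pseudospectrum\<close> is not strict.\<close>

lemma approximate_eigenvalue_in_pseudospectrum:
  assumes p: "p \<ge> 1" and per: "periodic_seq p a" "periodic_seq p b" "periodic_seq p c"
    and w: "\<And>n. \<bar>b n - c n\<bar> \<le> w" "w \<le> \<epsilon>"
    and approx: "\<And>e. e > 0 \<Longrightarrow> \<exists>u. norm u = 1 \<and>
      norm (jacobi a (\<lambda>n. (b n + c n) / 2) (\<lambda>n. (b n + c n) / 2) u - l *\<^sub>R u) < e"
  shows "complex_of_real l \<in> pseudospectrum \<epsilon> (jacobi a b c)"
proof (rule in_pseudospectrumI[OF w(2)])
  fix e :: real assume "e > 0"
  let ?S = "jacobi a (\<lambda>n. (b n + c n) / 2) (\<lambda>n. (b n + c n) / 2)"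
  obtain u where u: "norm u = 1" "norm (?S u - l *\<^sub>R u) < e"
    using approx[OF \<open>e > 0\<close>] by blast
  have r: "norm (jacobi a b c u - ?S u) \<le> w * norm u"
    by (intro norm_jacobi_diff_le bounded_periodic_seq[OF p] per w)
  have "complex_of_real l *\<^sub>C u - jacobi a b c u
      = - ((jacobi a b c u - ?S u) + (?S u - l *\<^sub>R u))"
    by (simp add: scaleR_scaleC)
  then have "norm (complex_of_real l *\<^sub>C u - jacobi a b c u)
      = norm ((jacobi a b c u - ?S u) + (?S u - l *\<^sub>R u))"
    by (simp only: norm_minus_cancel)
  also have "\<dots> \<le> w + e"
    using norm_triangle_ineq[of "jacobi a b c u - ?S u" "?S u - l *\<^sub>R u"] r u by simp
  finally show "\<exists>u. norm u = 1 \<and> norm (complex_of_real l *\<^sub>C u - jacobi a b c u) \<le> w + e"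
    using u(1) by blast
qed

section \<open>Traces and comparison of Dirichlet eigenvalues\<close>

text \<open>The operator is compressed to the \<open>p - 1\<close> sites strictly between
  \<open>i\<close> and \<open>i + p\<close>. The values of the form at the \<open>f k\<close> are
  the Dirichlet eigenvalues, and their sum is the trace in the unit vector basis.\<close>

lemma dirichlet_diagonalization:
  assumes p: "p \<ge> 1" and per: "periodic_seq p a" "periodic_seq p s"
  obtains f where "\<And>k. k < p - 1 \<Longrightarrow> real_supported {i<..<i + int p} (f k)"
    "diagonal_family (jacobi a s s) {..<p - 1} f"
    "\<And>k l. k \<le> l \<Longrightarrow> l < p - 1 \<Longrightarrow>
      inner (jacobi a s s (f l)) (f l) \<le> inner (jacobi a s s (f k)) (f k)"
    "(\<Sum>k<p - 1. inner (jacobi a s s (f k)) (f k)) = (\<Sum>n\<in>{i<..<i + int p}. a n)"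
proof -
  let ?T = "{i<..<i + int p}" and ?S = "jacobi a s s"
  let ?E = "unit_ell2 ` ?T"
  have "card ?E = p - 1"
    by (subst card_image[OF inj_on_subset[OF inj_unit_ell2 subset_UNIV]])
       (simp add: nat_diff_distrib)
  from diagonalizing_sequence[OF bounded_linear_A[OF p per] inner_A[OF p per] _
      orthonormal_unit_ell2 this]
  obtain f where f: "\<And>k. k < p - 1 \<Longrightarrow> f k \<in> span ?E" "\<And>k. k < p - 1 \<Longrightarrow> norm (f k) = 1"
    "\<And>k l. k < p - 1 \<Longrightarrow> l < p - 1 \<Longrightarrow> k \<noteq> l \<Longrightarrow> inner (f k) (f l) = 0"
    "\<And>k l. k < p - 1 \<Longrightarrow> l < p - 1 \<Longrightarrow> k \<noteq> l \<Longrightarrow> inner (?S (f k)) (f l) = 0"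
    "\<And>k l. k \<le> l \<Longrightarrow> l < p - 1 \<Longrightarrow> inner (?S (f l)) (f l) \<le> inner (?S (f k)) (f k)"
    "(\<Sum>k<p - 1. inner (?S (f k)) (f k)) = (\<Sum>e\<in>?E. inner (?S e) e)"
    by auto
  have "inner (?S (unit_ell2 n)) (unit_ell2 n) = a n" for n
    by (simp add: inner_unit_ell2 ell2_nth_A[OF p per] ell2_nth_simps)
  then have "(\<Sum>e\<in>?E. inner (?S e) e) = (\<Sum>n\<in>?T. a n)"
    by (subst sum.reindex[OF inj_on_subset[OF inj_unit_ell2 subset_UNIV]]) simp
  moreover have "diagonal_family ?S {..<p - 1} f"
    using f(2-4) by (auto simp: diagonal_family_def)
  moreover have "real_supported ?T (f k)" if "k < p - 1" for k
    using f(1)[OF that] span_unit_ell2_iff[of ?T "f k"] by simp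
  ultimately show thesis
    using that[of f] f(5,6) by simp
qed

text \<open>Any window of \<open>p\<close> sites has the same sum: when it slides by one, the
  entering entry equals the leaving one.\<close>

lemma sum_periodic_seq:
  assumes p: "p \<ge> 1" and per: "periodic_seq p a" and i: "0 \<le> i"
  shows "(\<Sum>n\<in>{i<..<i + int p}. a n) = (\<Sum>n\<in>{0..<int p}. a n) - a i"
proof -
  have split: "{i..<i + int p} = insert i {i<..<i + int p}" for i
    using p by auto
  have *: "(\<Sum>n\<in>{i<..<i + int p}. a n) = (\<Sum>n\<in>{i..<i + int p}. a n) - a i" for i
    unfolding split by simp
  have "(\<Sum>n\<in>{int k..<int k + int p}. a n) = (\<Sum>n\<in>{0..<int p}. a n)" for k
  proof (induction k)
    case (Suc k)
    have "{int (Suc k)..<int (Suc k) + int p} = insert (int k + int p) {int k<..<int k + int p}"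
      using p by auto
    then have "(\<Sum>n\<in>{int (Suc k)..<int (Suc k) + int p}. a n)
        = a (int k + int p) + (\<Sum>n\<in>{int k<..<int k + int p}. a n)"
      by simp
    also have "\<dots> = (\<Sum>n\<in>{int k..<int k + int p}. a n)"
      using per by (simp add: * periodic_seq_def)
    finally show ?case using Suc by simp
  qed simp
  from this[of "nat i"] show ?thesis
    using i by (simp add: *)
qed

text \<open>By the ordering, the form of \<open>S\<close> is at most its value at \<open>f k\<close>
  for indices from \<open>k\<close> on, and at least its value at \<open>g k\<close> for indices up
  to \<open>k\<close>. These are \<open>p - 1 - k\<close> and \<open>k + 1\<close> vectors; since
  both groups contain \<open>k\<close>, they reach the total \<open>p\<close> required by
  \<open>definite_blocks_bound\<close>.\<close>

lemma dirichlet_eigenvalue_gap: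
  fixes \<epsilon> w :: real
  assumes p: "p \<ge> 1" and per: "periodic_seq p a" "periodic_seq p b" "periodic_seq p c"
    and w: "\<And>n. \<bar>b n - c n\<bar> \<le> w" "w \<le> \<epsilon>"
    and conn: "connected (pseudospectrum \<epsilon> (jacobi a b c))"
  defines "S \<equiv> jacobi a (\<lambda>n. (b n + c n) / 2) (\<lambda>n. (b n + c n) / 2)"
  assumes i: "0 \<le> i" "i < int p" and j: "0 \<le> j" "j < int p" and k: "k < p - 1"
    and f: "\<And>t. t < p - 1 \<Longrightarrow> real_supported {i<..<i + int p} (f t)"
      "diagonal_family S {..<p - 1} f"
      "\<And>t t'. t \<le> t' \<Longrightarrow> t' < p - 1 \<Longrightarrow> inner (S (f t')) (f t') \<le> inner (S (f t)) (f t)"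
    and g: "\<And>t. t < p - 1 \<Longrightarrow> real_supported {j<..<j + int p} (g t)"
      "diagonal_family S {..<p - 1} g"
      "\<And>t t'. t \<le> t' \<Longrightarrow> t' < p - 1 \<Longrightarrow> inner (S (g t')) (g t') \<le> inner (S (g t)) (g t)"
  shows "inner (S (g k)) (g k) - inner (S (f k)) (f k) \<le> 2 * (\<epsilon> + w)"
proof (rule ccontr)
  let ?\<alpha> = "inner (S (f k)) (f k)" and ?\<beta> = "inner (S (g k)) (g k)"
  assume contra: "\<not> ?\<beta> - ?\<alpha> \<le> 2 * (\<epsilon> + w)"
  \<comment> \<open>Midpoint and half-length of the gap. The negated claim reads
    \<open>d > \<epsilon> + w\<close>, so a margin larger than \<open>\<epsilon>\<close> is left
    after the perturbation \<open>w\<close>.\<close>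
  define m where "m = (?\<alpha> + ?\<beta>) / 2"
  define d where "d = (?\<beta> - ?\<alpha>) / 2"
  define s where "s = (\<lambda>n. (b n + c n) / 2)"
  define A where "A = jacobi (\<lambda>n. a n - m) s s"
  have S: "S = jacobi a s s" by (simp add: S_def s_def)
  have "0 \<le> w" using w(1)[of 0] by simp
  then have d: "d > 0" "\<epsilon> < d - w" "0 \<le> \<epsilon>"
    using contra w(2) by (auto simp: d_def field_simps)
  have ps: "periodic_seq p s"
    unfolding s_def by (rule periodic_seq_map2[OF per(2,3)])
  have pa: "periodic_seq p (\<lambda>n. a n - m)"
    by (rule periodic_seq_map2[OF per(1) per(1)])
  note bounded = bounded_periodic_seq[OF p]
  have A: "inner (A u) v = inner (S u) v - m * inner u v" for u v
    unfolding A_def S by (subst jacobi_diff_scaleR) (simp_all add: bounded per ps inner_diff_left)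
  have diag: "diagonal_family A T h" if "diagonal_family S {..<p - 1} h" "T \<subseteq> {..<p - 1}" for T h
    using that unfolding diagonal_family_def A by (auto simp: subset_iff)
  have unit: "inner (h t) (h t) = 1" if "diagonal_family S {..<p - 1} h" "t < p - 1" for h t
    using that unfolding diagonal_family_def by (simp flip: power2_norm_eq_inner)
  have real_bound: "d * norm u \<le> norm (A u)" if "finite V" "real_supported V u" for V u
  proof (rule definite_blocks_bound[OF p pa ps d(1) _ _ _ i j, folded A_def])
    show "finite {k..<p - 1}" "finite {..k}" "card {k..<p - 1} + card {..k} = p"
      using k by auto
    show "\<forall>t\<in>{k..<p - 1}. real_supported {i<..<i + int p} (f t)"
      "\<forall>t\<in>{..k}. real_supported {j<..<j + int p} (g t)"
      using f(1) g(1) k by auto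
    show "diagonal_family A {k..<p - 1} f" "diagonal_family A {..k} g"
      using k by (auto intro!: diag f(2) g(2))
    show "inner (A (f t)) (f t) \<le> - d" if "t \<in> {k..<p - 1}" for t
      using f(3)[of k t] that unit[OF f(2), of t] by (simp add: A m_def d_def field_simps)
    show "d \<le> inner (A (g t)) (g t)" if "t \<in> {..k}" for t
      using g(3)[of t k] that k unit[OF g(2), of t] by (simp add: A m_def d_def field_simps)
  qed (use that in auto)
  have below: "d * norm u \<le> norm (A u)" for u
    by (rule bound_from_real_finite_support[OF p pa ps, folded A_def])
       (use d(1) real_bound in auto)
  have notin: "z \<notin> pseudospectrum \<epsilon> (jacobi a b c)" if z: "Re z = m" for z
  proof (rule notin_pseudospectrumI[where J' = "jacobi a c b" and \<delta> = "d - w"])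
    show "bounded_clinear (jacobi a b c)" "bounded_clinear (jacobi a c b)"
      by (intro bounded_clinear_jacobi bounded per)+
    show "inner (jacobi a b c x) y = inner x (jacobi a c b y)" for x y
      by (intro inner_jacobi bounded per)
    show "(d - w) * norm x \<le> norm (z *\<^sub>C x - jacobi a b c x)" for x
      using below by (intro norm_jacobi_resolvent_ge[OF p per w(1)]) (simp add: A_def s_def z)
    \<comment> \<open>The adjoint has the same symmetric part, and \<open>cnj z\<close> lies on the
      same vertical line, so the same estimate applies with \<open>b\<close> and \<open>c\<close>
      exchanged.\<close>
    show "(d - w) * norm x \<le> norm (cnj z *\<^sub>C x - jacobi a c b x)" for x
      using below w(1) by (intro norm_jacobi_resolvent_ge[OF p per(1,3,2)])
        (simp_all add: A_def s_def z add.commute abs_minus_commute)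
  qed (use d in auto)
  have S_props: "bounded_linear S" "\<And>x y. inner (S x) y = inner x (S y)"
    unfolding S by (rule bounded_linear_A[OF p per(1) ps], rule inner_A[OF p per(1) ps])
  have norms: "norm (f k) = 1" "norm (g k) = 1"
    using f(2) g(2) k by (auto simp: diagonal_family_def)
  obtain l1 where l1: "l1 \<le> ?\<alpha>"
    "\<And>e. e > 0 \<Longrightarrow> \<exists>u. norm u = 1 \<and> norm (S u - l1 *\<^sub>R u) < e"
    by (rule approximate_eigenvalue_below[OF S_props norms(1)]) (rule that)
  obtain l2 where l2: "?\<beta> \<le> l2"
    "\<And>e. e > 0 \<Longrightarrow> \<exists>u. norm u = 1 \<and> norm (S u - l2 *\<^sub>R u) < e"
    by (rule approximate_eigenvalue_above[OF S_props norms(2)]) (rule that)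
  have "complex_of_real l1 \<in> pseudospectrum \<epsilon> (jacobi a b c)"
    "complex_of_real l2 \<in> pseudospectrum \<epsilon> (jacobi a b c)"
    by (rule approximate_eigenvalue_in_pseudospectrum[OF p per w];
        use l1(2) l2(2) in \<open>simp add: S_def\<close>)+
  \<comment> \<open>\<open>inner 1 z\<close> is the real part of \<open>z\<close>: the points
    \<open>l1\<close> and \<open>l2\<close> lie on opposite sides of the line, which a connected set
    would have to meet.\<close>
  moreover have "inner 1 (complex_of_real l1) \<le> m" "m \<le> inner 1 (complex_of_real l2)"
    using l1(1) l2(1) d(1) by (auto simp: inner_complex_def m_def d_def field_simps)
  ultimately obtain z where "z \<in> pseudospectrum \<epsilon> (jacobi a b c)" "inner 1 z = m"
    using connected_ivt_hyperplane[OF conn] by blast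
  then show False
    using notin[of z] by (simp add: inner_complex_def)
qed

theorem theorem3p10:
  fixes p :: nat and a b c :: "int \<Rightarrow> real" and \<epsilon> :: real
  assumes "p \<ge> 1"
    and "periodic_seq p a" and "periodic_seq p b" and "periodic_seq p c"
    and "\<epsilon> \<ge> omega_bc p b c"
    and "path_connected (pseudospectrum \<epsilon> (jacobi a b c))"
  shows "omega_a a \<le> 2 * (\<epsilon> + omega_bc p b c) * (real p - 1)"
proof -
  note p = assms(1) and per = assms(2-4)
  define w where "w = omega_bc p b c"
  define S where "S = jacobi a (\<lambda>n. (b n + c n) / 2) (\<lambda>n. (b n + c n) / 2)"
  have ps: "periodic_seq p (\<lambda>n. (b n + c n) / 2)"
    by (rule periodic_seq_map2[OF per(2,3)])
  have w: "\<bar>b n - c n\<bar> \<le> w" for n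
  proof -
    have "{\<bar>b i - c i\<bar> |i. 0 \<le> i \<and> i < int p} = (\<lambda>i. \<bar>b i - c i\<bar>) ` {0..<int p}"
      by auto
    then have "\<bar>b (n mod int p) - c (n mod int p)\<bar> \<le> w"
      unfolding w_def omega_bc_def using p by (intro Max_ge) auto
    then show ?thesis
      using periodic_seq_mod[OF per(2), of n] periodic_seq_mod[OF per(3), of n] by simp
  qed
  have bound: "a i - a j \<le> 2 * (\<epsilon> + w) * (real p - 1)"
    if i: "0 \<le> i" "i < int p" and j: "0 \<le> j" "j < int p" for i j
  proof -
    obtain f where f: "\<And>k. k < p - 1 \<Longrightarrow> real_supported {i<..<i + int p} (f k)"
      "diagonal_family S {..<p - 1} f"
      "\<And>k l. k \<le> l \<Longrightarrow> l < p - 1 \<Longrightarrow> inner (S (f l)) (f l) \<le> inner (S (f k)) (f k)"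
      "(\<Sum>k<p - 1. inner (S (f k)) (f k)) = (\<Sum>n\<in>{i<..<i + int p}. a n)"
      by (rule dirichlet_diagonalization[OF p per(1) ps, folded S_def]) (rule that)
    obtain g where g: "\<And>k. k < p - 1 \<Longrightarrow> real_supported {j<..<j + int p} (g k)"
      "diagonal_family S {..<p - 1} g"
      "\<And>k l. k \<le> l \<Longrightarrow> l < p - 1 \<Longrightarrow> inner (S (g l)) (g l) \<le> inner (S (g k)) (g k)"
      "(\<Sum>k<p - 1. inner (S (g k)) (g k)) = (\<Sum>n\<in>{j<..<j + int p}. a n)"
      by (rule dirichlet_diagonalization[OF p per(1) ps, folded S_def]) (rule that)
    \<comment> \<open>Each trace is the sum of \<open>a\<close> over a full period minus the deleted
      entry, so the full sums cancel and the sign comes out as \<open>a i - a j\<close>.\<close>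
    have "a i - a j = (\<Sum>k<p - 1. inner (S (g k)) (g k) - inner (S (f k)) (f k))"
      using f(4) g(4) sum_periodic_seq[OF p per(1)] i j by (simp add: sum_subtractf)
    also have "\<dots> \<le> (\<Sum>k<p - 1. 2 * (\<epsilon> + w))"
    proof (rule sum_mono)
      fix k assume "k \<in> {..<p - 1}"
      then have k: "k < p - 1" by simp
      show "inner (S (g k)) (g k) - inner (S (f k)) (f k) \<le> 2 * (\<epsilon> + w)"
        by (rule dirichlet_eigenvalue_gap[where a = a and b = b and c = c and i = i and j = j,
              folded S_def])
          (fact p k per w assms(5)[folded w_def] path_connected_imp_connected[OF assms(6)] i j f g)+
    qed
    also have "\<dots> = 2 * (\<epsilon> + w) * (real p - 1)"
      using p by (simp add: of_nat_diff)
    finally show ?thesis .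
  qed
  have "\<bar>a i - a j\<bar> \<le> 2 * (\<epsilon> + w) * (real p - 1)" for i j
  proof -
    \<comment> \<open>Arbitrary indices are reduced to one period; exchanging the two indices
      supplies the absolute value.\<close>
    have "0 \<le> n mod int p \<and> n mod int p < int p" for n
      using p by simp
    then have "a (i mod int p) - a (j mod int p) \<le> 2 * (\<epsilon> + w) * (real p - 1)"
      "a (j mod int p) - a (i mod int p) \<le> 2 * (\<epsilon> + w) * (real p - 1)"
      using bound by blast+
    then show ?thesis
      using periodic_seq_mod[OF per(1), of i] periodic_seq_mod[OF per(1), of j] by simp
  qed
  then show ?thesis
    unfolding omega_a_def w_def[symmetric]
    by (subst Max_le_iff[OF finite_omega_a[OF p per(1)]]) auto
qed

end
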